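(* Let $\mathcal{X}=\{0,1,\ldots,n\}$, let $\mu$ be a probability distribution on $\mathcal{X}$ with $\mu(x)>0$ for all $x$, and let $Q$ be the generator of an ergodic birth-death chain on $\mathcal{X}$. Let $M_1=M_1(Q,\mu)$ and $M_2=M_2(Q,\mu)$ be the two Metropolis-Hastings generators, and for $j=1,2$ write the eigenvalues of $-M_j$ in ascending order as $0=\lambda_1(M_j)\leq\lambda_2(M_j)\leq\cdots\leq\lambda_{|\mathcal{X}|}(M_j)$. Then for every $i\in\{1,\ldots,|\mathcal{X}|\}$, $$\lambda_i(M_1)\leq\lambda_i(M_2).$$ Consequently, the fastest strong stationary times started at $0$ are ordered in Laplace transform: for every $\alpha>0$, $$\mathbb{E}_0(e^{-\alpha T_{sst}(M_2)})\geq\mathbb{E}_0(e^{-\alpha T_{sst}(M_1)}).$$ In particular, $$\mathbb{E}_0(T_{sst}(M_2))\leq\mathbb{E}_0(T_{sst}(M_1)),\qquad \mathrm{Var}_0(T_{sst}(M_2))\leq\mathrm{Var}_0(T_{sst}(M_1)).$$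
   Context: A generator $Q$ on $\{0,\ldots,n\}$ (nonnegative off-diagonal entries, zero row sums) is that of an ergodic birth-death chain if for $x\neq y$, $Q(x,y)>0$ if and only if $|x-y|=1$. Metropolis-Hastings generators: for $x\neq y$, $$M_1(x,y)=\min\Big\{Q(x,y),\tfrac{\mu(y)}{\mu(x)}Q(y,x)\Big\},\qquad M_2(x,y)=\max\Big\{Q(x,y),\tfrac{\mu(y)}{\mu(x)}Q(y,x)\Big\},$$ and $M_i(x,x)=-\sum_{z\neq x}M_i(x,z)$. Both $M_1$ and $M_2$ are ergodic birth-death generators with stationary distribution $\mu$. For an ergodic birth-death generator $G$ with stationary distribution $\pi$, the fastest strong stationary time $T_{sst}(G)$ starting from $0$ is a randomized stopping time whose law under $\mathbb{P}_0$ (chain started at $0$) is given, for $t>0$, by $$\mathbb{P}_0(T_{sst}(G)>t)=\max_{y\in\mathcal{X}}\Big\{1-\frac{e^{Gt}(0,y)}{\pi(y)}\Big\}.$$ $\mathbb{E}_0$ and $\mathrm{Var}_0$ denote expectation and variance under $\mathbb{P}_0$. *)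

theory Defs
  imports "HOL-Probability.Probability" "Jordan_Normal_Form.Char_Poly"
begin

section \<open>Generators on \<open>{0..n}\<close>\<close>

text \<open>Generators are square real matrices of dimension \<open>Suc n\<close>; row and column index \<open>x\<close>
  is the state \<open>x\<close>.\<close>

definition generator :: "nat \<Rightarrow> real mat \<Rightarrow> bool" where
  "generator n Q \<longleftrightarrow> Q \<in> carrier_mat (Suc n) (Suc n) \<and>
     (\<forall>x\<in>{0..n}. \<forall>y\<in>{0..n}. x \<noteq> y \<longrightarrow> 0 \<le> Q $$ (x, y)) \<and>
     (\<forall>x\<in>{0..n}. (\<Sum>y\<in>{0..n}. Q $$ (x, y)) = 0)"

definition ergodic_birth_death :: "nat \<Rightarrow> real mat \<Rightarrow> bool" where
  "ergodic_birth_death n Q \<longleftrightarrow> generator n Q \<and>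
     (\<forall>x\<in>{0..n}. \<forall>y\<in>{0..n}. x \<noteq> y \<longrightarrow> (0 < Q $$ (x, y) \<longleftrightarrow> \<bar>int x - int y\<bar> = 1))"

definition metropolis_hastings ::
  "(real \<Rightarrow> real \<Rightarrow> real) \<Rightarrow> nat \<Rightarrow> real mat \<Rightarrow> nat pmf \<Rightarrow> real mat" where
  "metropolis_hastings c n Q \<mu> =
     (let r = (\<lambda>x y. c (Q $$ (x, y)) (pmf \<mu> y / pmf \<mu> x * Q $$ (y, x)))
      in mat (Suc n) (Suc n) (\<lambda>(x, y). if x = y then - (\<Sum>z\<in>{0..n} - {x}. r x z) else r x y))"

definition M\<^sub>1 :: "nat \<Rightarrow> real mat \<Rightarrow> nat pmf \<Rightarrow> real mat" where
  "M\<^sub>1 = metropolis_hastings min"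

definition M\<^sub>2 :: "nat \<Rightarrow> real mat \<Rightarrow> nat pmf \<Rightarrow> real mat" where
  "M\<^sub>2 = metropolis_hastings max"

text \<open>The real eigenvalues of \<open>-G\<close>, with algebraic multiplicity, in ascending order.
  All \<open>dim_row G\<close> eigenvalues are listed exactly when the characteristic polynomial splits over
  the reals, as it does for reversible \<open>G\<close>.\<close>

definition neg_eigenvalues :: "real mat \<Rightarrow> real list" where
  "neg_eigenvalues G = sorted_list_of_multiset (proots (char_poly (- G)))"

definition eigval :: "nat \<Rightarrow> real mat \<Rightarrow> real" where
  "eigval i G = neg_eigenvalues G ! (i - 1)"

definition mat_exp :: "real mat \<Rightarrow> real mat" where
  "mat_exp A = mat (dim_row A) (dim_row A) (\<lambda>(x, y). \<Sum>k. (A ^\<^sub>m k) $$ (x, y) / fact k)"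


section \<open>Fastest strong stationary times\<close>

text \<open>\<open>X\<close> is a right-continuous Markov chain with generator \<open>G\<close>, started at 0, relative to the
  filtration \<open>F\<close>. The filtration may be larger than the natural one of \<open>X\<close>: the Markov property
  is required relative to \<open>F\<close>, so any additional information in \<open>F\<close> at time \<open>s\<close> is independent
  of the future of \<open>X\<close> given \<open>X s\<close>. A stopping time of such an \<open>F\<close> is a randomized stopping time
  of \<open>X\<close>. Only times \<open>t \<ge> 0\<close> are relevant.\<close>

definition markov_chain_from_0 ::
  "nat \<Rightarrow> real mat \<Rightarrow> 'a measure \<Rightarrow> (real \<Rightarrow> 'a measure) \<Rightarrow> (real \<Rightarrow> 'a \<Rightarrow> nat) \<Rightarrow> bool" where
  "markov_chain_from_0 n G P F X \<longleftrightarrow>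
     prob_space P \<and> filtration (space P) F \<and> (\<forall>t. sets (F t) \<subseteq> sets P) \<and>
     (\<forall>t\<ge>0. X t \<in> measurable (F t) (count_space {0..n})) \<and>
     (\<forall>\<omega>\<in>space P. \<forall>t\<ge>0. eventually (\<lambda>s. X s \<omega> = X t \<omega>) (at_right t)) \<and>
     (AE \<omega> in P. X 0 \<omega> = 0) \<and>
     (\<forall>s\<ge>0. \<forall>t\<ge>0. \<forall>A\<in>sets (F s). \<forall>x\<in>{0..n}. \<forall>y\<in>{0..n}.
        measure P {\<omega>\<in>A. X s \<omega> = x \<and> X (s + t) \<omega> = y}
          = measure P {\<omega>\<in>A. X s \<omega> = x} * mat_exp (t \<cdot>\<^sub>m G) $$ (x, y))"

text \<open>\<open>T\<close> is a strong stationary time if \<open>X\<close> at time \<open>T\<close> has law \<open>\<pi>\<close> and is independent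
  of \<open>T\<close>.\<close>

definition strong_stationary_time ::
  "nat \<Rightarrow> real mat \<Rightarrow> nat pmf \<Rightarrow> 'a measure \<Rightarrow> (real \<Rightarrow> 'a measure) \<Rightarrow> (real \<Rightarrow> 'a \<Rightarrow> nat)
     \<Rightarrow> ('a \<Rightarrow> real) \<Rightarrow> bool" where
  "strong_stationary_time n G \<pi> P F X T \<longleftrightarrow>
     markov_chain_from_0 n G P F X \<and> stopping_time F T \<and> (\<forall>\<omega>\<in>space P. 0 \<le> T \<omega>) \<and>
     (\<forall>t\<ge>0. \<forall>y\<in>{0..n}.
        measure P {\<omega>\<in>space P. T \<omega> \<le> t \<and> X (T \<omega>) \<omega> = y}
          = measure P {\<omega>\<in>space P. T \<omega> \<le> t} * pmf \<pi> y)"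

text \<open>Here \<open>\<pi>\<close> is the stationary distribution of \<open>G\<close>. The tail of the fastest strong stationary
  time is the separation distance of the chain from stationarity.\<close>

definition fastest_strong_stationary_time ::
  "nat \<Rightarrow> real mat \<Rightarrow> nat pmf \<Rightarrow> 'a measure \<Rightarrow> (real \<Rightarrow> 'a measure) \<Rightarrow> (real \<Rightarrow> 'a \<Rightarrow> nat)
     \<Rightarrow> ('a \<Rightarrow> real) \<Rightarrow> bool" where
  "fastest_strong_stationary_time n G \<pi> P F X T \<longleftrightarrow>
     strong_stationary_time n G \<pi> P F X T \<and>
     (\<forall>t>0. measure P {\<omega>\<in>space P. T \<omega> > t}
              = (MAX y\<in>{0..n}. 1 - mat_exp (t \<cdot>\<^sub>m G) $$ (0, y) / pmf \<pi> y))"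

end

theory Submission
  imports Defs "HOL-Real_Asymp.Real_Asymp"
begin

text \<open>
  Both Metropolis-Hastings generators are those of reversible birth-death chains with the same weights
  \<open>\<mu>\<close>, and the rates of \<open>M\<^sub>1\<close> are dominated by those of \<open>M\<^sub>2\<close>, because \<open>min \<le> max\<close>. Hence the
  Dirichlet forms, taken in the same space \<open>l2(\<mu>)\<close>, are ordered, and the Courant-Fischer principle orders the
  eigenvalues (\<open>eigenvalues_mono_in_rates\<close>). For this one needs that a birth-death generator is
  diagonalisable with real spectrum. That comes from Sturm's theorem on three-term recurrences
  (\<open>jacobi_poly_real_roots_interlace\<close>): the characteristic polynomial has \<open>n + 1\<close> distinct real roots, so
  explicit eigenfunctions, which are orthogonal by reversibility, form a basis.

  The probabilistic statements follow because the law of the fastest strong stationary time from \<open>0\<close>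
  depends on the eigenvalues only: it is the law of a sum of independent exponential variables
  with the nonzero eigenvalues \<open>lam 1, \<dots>, lam n\<close> as rates. To see this, note first that the semigroup of a birth-death chain maps
  decreasing functions to decreasing functions, so the separation is attained at the state \<open>n\<close> and the tail of the
  time is \<open>- (\<Sum>i=1..n. w i * exp (- lam i * t))\<close> with \<open>w i = u i 0 * u i n\<close> for the orthonormal
  eigenfunctions \<open>u i\<close> (\<open>separation_eq\<close>). Since \<open>n\<close> is at distance \<open>n\<close> from \<open>0\<close>, the entry \<open>(0, n)\<close>
  of every power of the generator below the \<open>n\<close>-th vanishes. So \<open>w\<close> annihilates the polynomials of degree below
  \<open>n\<close> in the eigenvalues, which together with \<open>w 0 = 1\<close> determines \<open>w\<close> (\<open>w_mult_prod_diff\<close>). Lagrange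
  interpolation then turns the Laplace transform of the tail into \<open>\<Prod>j=1..n. lam j / (\<alpha> + lam j)\<close>
  (\<open>partial_fractions\<close>), and two derivatives at \<open>\<alpha> = 0\<close> give the mean \<open>\<Sum>j=1..n. 1 / lam j\<close> and the
  variance \<open>\<Sum>j=1..n. 1 / (lam j)\<^sup>2\<close>. All three are monotone in each eigenvalue.
\<close>

section \<open>Real roots of Jacobi polynomials\<close>

text \<open>The characteristic polynomials of the leading principal submatrices of a Jacobi matrix with diagonal
  \<open>a 0, a 1, \<dots>\<close>, where \<open>e k\<close> is the product of the two entries that couple \<open>k\<close> and \<open>k + 1\<close>.\<close>

fun jacobi_poly :: "(nat \<Rightarrow> real) \<Rightarrow> (nat \<Rightarrow> real) \<Rightarrow> nat \<Rightarrow> real poly" where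
  "jacobi_poly a e 0 = 1"
| "jacobi_poly a e (Suc 0) = [:- a 0, 1:]"
| "jacobi_poly a e (Suc (Suc k)) =
     [:- a (Suc k), 1:] * jacobi_poly a e (Suc k) - Polynomial.smult (e k) (jacobi_poly a e k)"

lemma degree_lead_coeff_jacobi_poly:
  "degree (jacobi_poly a e k) = k \<and> lead_coeff (jacobi_poly a e k) = 1"
proof (induction k rule: less_induct)
  case (less k)
  consider "k = 0" | "k = Suc 0" | j where "k = Suc (Suc j)"
    by (metis not0_implies_Suc)
  then show ?case
  proof cases
    case 3
    let ?p = "[:- a (Suc j), 1:] * jacobi_poly a e (Suc j)"
    let ?q = "Polynomial.smult (e j) (jacobi_poly a e j)"
    have "Suc j < k" "j < k" using 3 by auto
    note IH' = less.IH[OF this(1)] less.IH[OF this(2)]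
    have IH: "degree (jacobi_poly a e (Suc j)) = Suc j" "lead_coeff (jacobi_poly a e (Suc j)) = 1"
      "degree (jacobi_poly a e j) = j"
      using IH' by blast+
    have nz: "jacobi_poly a e (Suc j) \<noteq> 0" using IH by auto
    have dp: "degree ?p = Suc (Suc j)"
      using nz IH by (subst degree_mult_eq) auto
    have lp: "lead_coeff ?p = 1"
      using IH by (simp only: lead_coeff_mult) simp
    have dq: "degree ?q < degree ?p" using dp IH degree_smult_le[of "e j" "jacobi_poly a e j"] by simp
    have "degree (?p - ?q) = degree ?p"
      using degree_add_eq_left[of "- ?q" ?p] dq by simp
    moreover have "coeff (?p - ?q) (degree ?p) = lead_coeff ?p"
      using dq by (simp only: coeff_diff coeff_eq_0)
    ultimately show ?thesis using 3 dp lp by simp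
  qed auto
qed

text \<open>Only the factors with \<open>i \<le> j\<close> are negative, and there are \<open>k - i\<close> of them.\<close>

lemma sgn_prod_diff_between:
  fixes x :: "nat \<Rightarrow> real"
  assumes "i \<le> k" "\<And>j. j < i \<Longrightarrow> x j < z" "\<And>j. i \<le> j \<Longrightarrow> j < k \<Longrightarrow> z < x j"
  shows "0 < (-1) ^ (k - i) * (\<Prod>j<k. z - x j)"
proof -
  have "(\<Prod>j<k. z - x j) = (\<Prod>j<i. z - x j) * (\<Prod>j=i..<k. z - x j)"
    using assms(1) prod.atLeastLessThan_concat[of 0 i k "\<lambda>j. z - x j"]
    by (simp add: lessThan_atLeast0)
  also have "(\<Prod>j=i..<k. z - x j) = (\<Prod>j=i..<k. (-1) * (x j - z))"
    by (intro prod.cong) auto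
  also have "\<dots> = (-1) ^ (k - i) * (\<Prod>j=i..<k. x j - z)"
    by (simp only: prod.distrib) simp
  finally have "(-1) ^ (k - i) * (\<Prod>j<k. z - x j) =
     ((-1) ^ (k - i) * (-1) ^ (k - i)) * ((\<Prod>j<i. z - x j) * (\<Prod>j=i..<k. x j - z))"
    by (simp only: mult_ac)
  moreover have "((-1) ^ (k - i) * (-1) ^ (k - i) :: real) = 1"
    by (simp flip: power_add mult_2)
  moreover have "0 < (\<Prod>j<i. z - x j)" "0 < (\<Prod>j=i..<k. x j - z)"
    using assms by (auto intro!: prod_pos)
  ultimately show ?thesis by simp
qed

lemma monic_poly_eq_prod_roots:
  fixes p :: "real poly"
  assumes "degree p = k" "lead_coeff p = 1" "inj_on x {..<k}" "\<And>i. i < k \<Longrightarrow> poly p (x i) = 0"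
  shows "p = (\<Prod>i<k. [:- x i, 1:])"
proof (rule poly_eqI_degree_lead_coeff)
  show "poly p y = poly (\<Prod>i<k. [:- x i, 1:]) y" if "y \<in> x ` {..<k}" for y
    using that assms(4) by (auto simp: poly_prod)
  show "card (x ` {..<k}) \<ge> k" using assms(3) by (simp add: card_image)
  show "degree p \<le> k" using assms by simp
  have d: "degree (\<Prod>i<k. [:- x i, 1:]) = k"
    by (subst degree_prod_eq_sum_degree) auto
  then show "degree (\<Prod>i<k. [:- x i, 1:]) \<le> k" by simp
  have "lead_coeff (\<Prod>i<k. [:- x i, 1:]) = (\<Prod>i<k. lead_coeff [:- x i, 1:])"
    by (rule lead_coeff_prod)
  then show "coeff p k = coeff (\<Prod>i<k. [:- x i, 1:]) k" using d assms by simp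
qed

lemma monic_poly_sign_at_infinity:
  fixes p :: "real poly"
  assumes "degree p = k" "lead_coeff p = 1"
  obtains B where "\<And>y. y \<ge> B \<Longrightarrow> 0 < poly p y" "\<And>y. y \<ge> B \<Longrightarrow> 0 < (-1) ^ k * poly p (- y)"
proof -
  obtain B1 where B1: "\<forall>y\<ge>B1. lead_coeff p \<le> poly p y"
    using poly_pinfty_gt_lc[of p] assms by auto
  define q where "q = Polynomial.smult ((-1) ^ k) (p \<circ>\<^sub>p [:0, -1:])"
  have "lead_coeff (p \<circ>\<^sub>p [:0, -1:]) = (-1) ^ k"
    using assms by (subst lead_coeff_comp) auto
  then have "lead_coeff q = 1"
    by (simp add: q_def flip: power_add mult_2)
  then obtain B2 where B2: "\<forall>y\<ge>B2. lead_coeff q \<le> poly q y"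
    using poly_pinfty_gt_lc[of q] by auto
  have "0 < (-1) ^ k * poly p (- y)" if "y \<ge> max B1 B2" for y
  proof -
    have "1 \<le> poly q y" using B2 that \<open>lead_coeff q = 1\<close> by auto
    then show ?thesis by (simp add: q_def poly_pcompose)
  qed
  moreover have "0 < poly p y" if "y \<ge> max B1 B2" for y
    using B1[rule_format, of y] assms that by simp
  ultimately show ?thesis using that by blast
qed

lemma mult_neg_of_opposite_signs:
  fixes s t :: real
  assumes "0 < (-1) ^ Suc m * s" "0 < (-1) ^ m * t"
  shows "s * t < 0"
  using assms by (cases "even m") (auto simp: mult_less_0_iff)

text \<open>Sturm's argument. At a root \<open>x\<close> of \<open>J k\<close> the recurrence reduces to
  \<open>J (k + 1) x = - e * J (k - 1) x\<close>, so if \<open>J (k - 1)\<close> alternates in sign along the roots of \<open>J k\<close>,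
  then so does \<open>J (k + 1)\<close>; with its signs at infinity it changes sign once in each of the
  \<open>k + 1\<close> gaps. The alternation of \<open>J (k - 1)\<close> is carried through the induction because it is what
  makes the next step work.\<close>

lemma jacobi_poly_real_roots_interlace:
  assumes "\<And>k. Suc k < N \<Longrightarrow> 0 < e k"
  shows "\<exists>x. strict_mono_on {..<N} x \<and> jacobi_poly a e N = (\<Prod>i<N. [:- x i, 1:]) \<and>
     (\<forall>i<N. 0 < (-1) ^ (N - Suc i) * poly (jacobi_poly a e (N - 1)) (x i))"
  using assms
proof (induction N)
  case 0
  show ?case by (auto simp: monotone_on_def)
next
  case (Suc k)
  show ?case
  proof (cases k)
    case 0
    show ?thesis
      by (rule exI[of _ "\<lambda>_. a 0"]) (auto simp: 0 monotone_on_def)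
  next
    case (Suc l)
    let ?J = "jacobi_poly a e"
    obtain x where mono: "strict_mono_on {..<k} x" and fac: "?J k = (\<Prod>i<k. [:- x i, 1:])"
      and sgn: "\<And>i. i < k \<Longrightarrow> 0 < (-1) ^ (k - Suc i) * poly (?J l) (x i)"
      using Suc.IH Suc.prems Suc by auto
    have xless: "x i < x j" if "i < j" "j < k" for i j
      using mono that by (auto simp: monotone_on_def)
    obtain B0 where B0: "\<And>y. y \<ge> B0 \<Longrightarrow> 0 < poly (?J (Suc k)) y"
      "\<And>y. y \<ge> B0 \<Longrightarrow> 0 < (-1) ^ (Suc k) * poly (?J (Suc k)) (- y)"
      using monic_poly_sign_at_infinity degree_lead_coeff_jacobi_poly by metis
    define B where "B = Max (insert B0 ((\<lambda>i. \<bar>x i\<bar> + 1) ` {..<k}))"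
    have B: "B \<ge> B0" "\<And>i. i < k \<Longrightarrow> \<bar>x i\<bar> + 1 \<le> B"
      unfolding B_def by (auto intro!: Max_ge)
    \<comment> \<open>The points between which \<open>J (k + 1)\<close> changes sign: the roots of \<open>J k\<close>, framed by two points
      so far out that the leading term decides the sign there.\<close>
    define y where "y i = (if i = 0 then - B else if i \<le> k then x (i - 1) else B)" for i
    have yless: "y i < y (Suc i)" if "i \<le> k" for i
    proof (cases "i = 0 \<or> i = k")
      case True
      then show ?thesis using B(2)[of 0] B(2)[of "k - 1"] Suc by (auto simp: y_def)
    next
      case False
      then show ?thesis using xless[of "i - 1" i] that by (auto simp: y_def)
    qed
    have ysgn: "0 < (-1) ^ (Suc k - i) * poly (?J (Suc k)) (y i)" if "i \<le> Suc k" for i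
    proof -
      have "i = 0 \<or> i = Suc k \<or> (\<exists>j. i = Suc j \<and> j < k)"
        using that by (cases i) auto
      then consider "i = 0" | "i = Suc k" | j where "i = Suc j" "j < k"
        by blast
      then show ?thesis
      proof cases
        case 1 then show ?thesis using B0(2) B by (simp add: y_def)
      next
        case 2 then show ?thesis using B0(1) B by (simp add: y_def)
      next
        case 3
        have "poly (?J k) (x j) = 0"
          unfolding fac poly_prod using 3 by (intro prod_zero) auto
        then have "poly (?J (Suc k)) (x j) = - (e l * poly (?J l) (x j))"
          using Suc by simp
        moreover have "Suc k - i = Suc (k - Suc j)" "y i = x j" using 3 by (auto simp: y_def)
        moreover have "0 < e l * ((-1) ^ (k - Suc j) * poly (?J l) (x j))"
          by (rule mult_pos_pos) (use sgn[of j] 3 Suc.prems[of l] Suc in auto)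
        ultimately show ?thesis by (simp only: power_Suc) (simp add: mult_ac)
      qed
    qed
    have "\<exists>z. y i < z \<and> z < y (Suc i) \<and> poly (?J (Suc k)) z = 0" if "i \<le> k" for i
    proof (rule poly_IVT[OF yless[OF that], of "?J (Suc k)", simplified])
      have eq: "Suc k - i = Suc (Suc k - Suc i)" using that by simp
      show "poly (?J (Suc k)) (y i) * poly (?J (Suc k)) (y (Suc i)) < 0"
        using ysgn[of i] ysgn[of "Suc i"] that eq
        by (intro mult_neg_of_opposite_signs[of "Suc k - Suc i"]) auto
    qed
    then obtain z where z: "\<And>i. i \<le> k \<Longrightarrow> y i < z i \<and> z i < y (Suc i) \<and> poly (?J (Suc k)) (z i) = 0"
      by metis
    have yle: "y i \<le> y j" if "i \<le> j" "j \<le> Suc k" for i j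
      using that
    proof (induction j)
      case (Suc j)
      then show ?case using yless[of j] by (cases "i = Suc j") auto
    qed simp
    have zmono: "strict_mono_on {..<Suc k} z"
    proof (rule strict_mono_onI)
      fix i j assume "i \<in> {..<Suc k}" "j \<in> {..<Suc k}" "i < j"
      then show "z i < z j" using z[of i] z[of j] yle[of "Suc i" j] by force
    qed
    have "?J (Suc k) = (\<Prod>i<Suc k. [:- z i, 1:])"
      using degree_lead_coeff_jacobi_poly[of a e "Suc k"] z strict_mono_on_imp_inj_on[OF zmono]
      by (intro monic_poly_eq_prod_roots) auto
    moreover have "0 < (-1) ^ (k - i) * poly (?J k) (z i)" if "i \<le> k" for i
    proof -
      have "0 < (-1) ^ (k - i) * (\<Prod>j<k. z i - x j)"
      proof (rule sgn_prod_diff_between[OF that])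
        fix j assume j: "j < i"
        have "x j = y (Suc j)" using j that by (simp add: y_def)
        then show "x j < z i" using yle[of "Suc j" i] z[OF that] j that by force
      next
        fix j assume j: "i \<le> j" "j < k"
        have "x j = y (Suc j)" using j by (simp add: y_def)
        then show "z i < x j" using yle[of "Suc i" "Suc j"] z[OF that] j by force
      qed
      then show ?thesis by (simp add: fac poly_prod)
    qed
    ultimately show ?thesis using zmono by (auto simp: less_Suc_eq_le)
  qed
qed

section \<open>Reversible birth-death chains and their eigenfunctions\<close>

text \<open>A chain that moves up at rate \<open>b x\<close> and down at rate \<open>d x\<close>, reversible with respect to the
  probability weights \<open>m\<close>. The conventions \<open>b n = 0\<close> and \<open>d 0 = 0\<close> let the formulas below hold at the
  two end states without case distinction.\<close>

locale reversible_birth_death =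
  fixes n :: nat and m b d :: "nat \<Rightarrow> real"
  assumes m_pos: "x \<le> n \<Longrightarrow> 0 < m x"
    and m_sum: "(\<Sum>x\<le>n. m x) = 1"
    and b_pos: "x < n \<Longrightarrow> 0 < b x"
    and b_n: "b n = 0"
    and d_0: "d 0 = 0"
    and detailed_balance: "x < n \<Longrightarrow> m x * b x = m (Suc x) * d (Suc x)"
begin

text \<open>\<open>L\<close> is minus the generator, acting on functions, so that its eigenvalues are the nonnegative
  numbers of interest. At \<open>x = 0\<close> the term \<open>f (x - 1)\<close> is \<open>f 0\<close>, and at \<open>x = n\<close> the value \<open>f (Suc n)\<close>
  is multiplied by \<open>b n = 0\<close>.\<close>

definition L :: "(nat \<Rightarrow> real) \<Rightarrow> nat \<Rightarrow> real" where
  "L f x = b x * (f x - f (Suc x)) + d x * (f x - f (x - 1))"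

definition inner_m :: "(nat \<Rightarrow> real) \<Rightarrow> (nat \<Rightarrow> real) \<Rightarrow> real" where
  "inner_m f g = (\<Sum>x\<le>n. m x * f x * g x)"

definition gen_mat :: "real mat" where
  "gen_mat = mat (Suc n) (Suc n) (\<lambda>(x, y). if y = Suc x then b x else if x = Suc y then d x
     else if x = y then - (b x + d x) else 0)"

lemma d_pos: "x < n \<Longrightarrow> 0 < d (Suc x)"
  using detailed_balance[of x] m_pos[of x] m_pos[of "Suc x"] b_pos[of x]
  by (metis Suc_leI less_imp_le mult_pos_pos zero_less_mult_pos)

lemma d_nonneg: "x \<le> n \<Longrightarrow> 0 \<le> d x"
  using d_pos[of "x - 1"] d_0 by (cases x) (auto simp: less_imp_le)

lemma b_nonneg: "x \<le> n \<Longrightarrow> 0 \<le> b x"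
  using b_pos[of x] b_n by (cases "x = n") (auto simp: less_imp_le)

lemma L_sum:
  "L (\<lambda>x. \<Sum>i\<in>I. \<alpha> i * u i x) x = (\<Sum>i\<in>I. \<alpha> i * L (u i) x)"
  by (simp add: L_def sum_subtractf sum_distrib_left algebra_simps sum.distrib)

lemma inner_m_commute: "inner_m f g = inner_m g f"
  by (simp add: inner_m_def mult_ac)

lemma inner_m_sum_right: "inner_m f (\<lambda>x. \<Sum>i\<in>I. \<alpha> i * u i x) = (\<Sum>i\<in>I. \<alpha> i * inner_m f (u i))"
proof -
  have "inner_m f (\<lambda>x. \<Sum>i\<in>I. \<alpha> i * u i x) = (\<Sum>x\<le>n. \<Sum>i\<in>I. \<alpha> i * (m x * f x * u i x))"
    by (simp add: inner_m_def sum_distrib_left mult_ac)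
  also have "\<dots> = (\<Sum>i\<in>I. \<alpha> i * inner_m f (u i))"
    by (subst sum.swap) (simp add: inner_m_def sum_distrib_left)
  finally show ?thesis .
qed

text \<open>Summation by parts: detailed balance pairs the upward jumps from \<open>x\<close> with the downward jumps
  from \<open>x + 1\<close>. Both the symmetry of \<open>L\<close> and its monotone dependence on the rates are read off the
  right-hand side.\<close>

lemma inner_m_L_eq_dirichlet_form:
  "inner_m f (L g) = (\<Sum>x<n. m x * b x * (f x - f (Suc x)) * (g x - g (Suc x)))"
proof -
  have "inner_m f (L g) = (\<Sum>x\<le>n. m x * f x * b x * (g x - g (Suc x)))
      + (\<Sum>x\<le>n. m x * f x * d x * (g x - g (x - 1)))"
    unfolding inner_m_def L_def by (simp add: sum.distrib[symmetric] algebra_simps)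
  also have "(\<Sum>x\<le>n. m x * f x * b x * (g x - g (Suc x)))
      = (\<Sum>x<n. m x * f x * b x * (g x - g (Suc x)))"
    by (simp flip: lessThan_Suc_atMost add: b_n)
  also have "(\<Sum>x\<le>n. m x * f x * d x * (g x - g (x - 1)))
      = (\<Sum>x<n. m (Suc x) * f (Suc x) * d (Suc x) * (g (Suc x) - g x))"
    by (simp only: sum.atMost_shift) (simp add: d_0)
  also have "\<dots> = (\<Sum>x<n. m x * b x * f (Suc x) * (g (Suc x) - g x))"
    by (intro sum.cong) (auto simp: detailed_balance)
  finally show ?thesis
    by (simp add: sum.distrib[symmetric] algebra_simps)
qed

lemma L_symmetric: "inner_m f (L g) = inner_m (L f) g"
  by (subst (2) inner_m_commute) (simp add: inner_m_L_eq_dirichlet_form mult_ac)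

lemma gen_mat_carrier [simp]: "gen_mat \<in> carrier_mat (Suc n) (Suc n)"
  "dim_row gen_mat = Suc n" "dim_col gen_mat = Suc n"
  by (auto simp: gen_mat_def)

lemma gen_mat_apply:
  assumes "x \<le> n"
  shows "(\<Sum>y\<le>n. gen_mat $$ (x, y) * f y) = - L f x"
proof -
  have "(\<Sum>y\<le>n. gen_mat $$ (x, y) * f y) =
    (\<Sum>y\<le>n. (if y = Suc x then b x * f (Suc x) else 0)
      + (if y = x - 1 then d x * f (x - 1) else 0) + (if y = x then - (b x + d x) * f x else 0))"
    using assms d_0 by (intro sum.cong) (auto simp: gen_mat_def)
  also have "\<dots> = (if Suc x \<le> n then b x * f (Suc x) else 0) + d x * f (x - 1) - (b x + d x) * f x"
    using assms le_trans[OF diff_le_self assms, of 1] by (simp add: sum.distrib algebra_simps)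
  also have "\<dots> = - L f x"
    using assms b_n by (cases "x = n") (auto simp: L_def algebra_simps)
  finally show ?thesis .
qed

lemma gen_mat_reversible:
  assumes "x \<le> n" "y \<le> n"
  shows "m x * gen_mat $$ (x, y) = m y * gen_mat $$ (y, x)"
  using assms detailed_balance[of x] detailed_balance[of y] by (auto simp: gen_mat_def)

text \<open>The eigenvalue equation at the states \<open>0, \<dots>, n - 1\<close> determines \<open>f\<close> recursively from \<open>f 0 = 1\<close>; after
  rescaling, \<open>f x\<close> is the \<open>x\<close>-th Jacobi polynomial in the spectral parameter. The remaining equation, at
  \<open>x = n\<close>, says that the parameter is a root of the polynomial of index \<open>n + 1\<close>.\<close>

lemma exists_eigenfunctions:
  "\<exists>lam f. strict_mono_on {..n} lam \<and> (\<forall>i\<le>n. \<forall>x\<le>n. L (f i) x = lam i * f i x) \<and> (\<forall>i\<le>n. f i 0 = (1::real))"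
proof -
  define a where "a x = b x + d x" for x
  define e where "e x = b x * d (Suc x)" for x
  let ?J = "jacobi_poly a e"
  have "\<exists>x. strict_mono_on {..<Suc n} x \<and> ?J (Suc n) = (\<Prod>i<Suc n. [:- x i, 1:]) \<and>
     (\<forall>i<Suc n. 0 < (-1) ^ (Suc n - Suc i) * poly (?J (Suc n - 1)) (x i))"
    by (rule jacobi_poly_real_roots_interlace) (auto simp: e_def b_pos d_pos)
  then obtain lam where lam: "strict_mono_on {..n} lam" "?J (Suc n) = (\<Prod>i\<le>n. [:- lam i, 1:])"
    unfolding lessThan_Suc_atMost by blast
  have root: "poly (?J (Suc n)) (lam i) = 0" if "i \<le> n" for i
    unfolding lam(2) poly_prod using that by (intro prod_zero) auto
  define B where "B x = (\<Prod>j<x. b j)" for x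
  have B_pos: "0 < B x" if "x \<le> n" for x
    unfolding B_def using that by (intro prod_pos) (auto simp: b_pos)
  define f where "f i x = (-1) ^ x * poly (?J x) (lam i) / B x" for i x
  have "L (f i) x = lam i * f i x" if "i \<le> n" "x \<le> n" for i x
  proof -
    let ?\<psi> = "\<lambda>x. poly (?J x) (lam i)"
    have rec: "?\<psi> (Suc x) = (lam i - a x) * ?\<psi> x - (if x = 0 then 0 else e (x - 1) * ?\<psi> (x - 1))"
      by (cases x) (auto simp: algebra_simps)
    \<comment> \<open>For \<open>x = n\<close> both sides vanish, the right one because \<open>lam i\<close> is a root.\<close>
    have up: "b x * f i (Suc x) = - ((-1) ^ x * ?\<psi> (Suc x) / B x)"
    proof (cases "x = n")
      case True
      then show ?thesis using b_n root[OF that(1)] by simp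
    next
      case False
      then have "b x \<noteq> 0" using that b_pos[of x] by simp
      then show ?thesis by (simp add: f_def B_def field_simps)
    qed
    have down: "d x * f i (x - 1) = - ((-1) ^ x * (if x = 0 then 0 else e (x - 1) * ?\<psi> (x - 1)) / B x)"
    proof (cases x)
      case 0
      then show ?thesis using d_0 by simp
    next
      case (Suc y)
      then have "b y \<noteq> 0" using that b_pos[of y] by simp
      then show ?thesis using Suc by (simp add: f_def B_def e_def field_simps)
    qed
    have "L (f i) x = a x * f i x - b x * f i (Suc x) - d x * f i (x - 1)"
      by (simp add: L_def a_def algebra_simps)
    also have "\<dots> = (-1) ^ x / B x * (a x * ?\<psi> x + ?\<psi> (Suc x) + (if x = 0 then 0 else e (x - 1) * ?\<psi> (x - 1)))"
      unfolding up down by (simp add: f_def algebra_simps add_divide_distrib)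
    also have "\<dots> = lam i * f i x"
      unfolding rec by (simp add: f_def algebra_simps)
    finally show ?thesis .
  qed
  moreover have "f i 0 = 1" for i by (simp add: f_def B_def)
  ultimately show ?thesis using lam(1) by blast
qed

text \<open>Eigenfunctions of a symmetric operator with distinct eigenvalues are orthogonal, and
  \<open>f i 0 = 1\<close> guarantees that they can be normalised.\<close>

lemma exists_orthonormal_eigenbasis:
  "\<exists>lam u. strict_mono_on {..n} lam \<and> (\<forall>i\<le>n. \<forall>x\<le>n. L (u i) x = lam i * u i x) \<and>
     (\<forall>i\<le>n. \<forall>j\<le>n. inner_m (u i) (u j) = (if i = j then 1 else 0))"
proof -
  obtain lam f where mono: "strict_mono_on {..n} lam"
    and eig: "\<And>i x. i \<le> n \<Longrightarrow> x \<le> n \<Longrightarrow> L (f i) x = lam i * f i x"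
    and f0: "\<And>i. i \<le> n \<Longrightarrow> f i 0 = (1::real)"
    using exists_eigenfunctions by blast
  have orth: "inner_m (f i) (f j) = 0" if "i \<le> n" "j \<le> n" "i \<noteq> j" for i j
  proof -
    have "lam j * inner_m (f i) (f j) = inner_m (f i) (L (f j))"
      unfolding inner_m_def sum_distrib_left using that by (intro sum.cong) (auto simp: eig)
    also have "\<dots> = lam i * inner_m (f i) (f j)"
      unfolding L_symmetric unfolding inner_m_def sum_distrib_left
      using that by (intro sum.cong) (auto simp: eig)
    finally show ?thesis
      using strict_mono_on_imp_inj_on[OF mono] that by (auto simp: inj_on_def)
  qed
  have norm_pos: "0 < inner_m (f i) (f i)" if "i \<le> n" for i
    unfolding inner_m_def
    by (rule sum_pos2[of _ 0]) (use that f0 m_pos in \<open>auto simp: mult.assoc zero_le_mult_iff less_imp_le\<close>)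
  define c where "c i = 1 / sqrt (inner_m (f i) (f i))" for i
  define u where "u i x = c i * f i x" for i x
  have "inner_m (u i) (u j) = c i * c j * inner_m (f i) (f j)" for i j
    by (simp add: inner_m_def u_def sum_distrib_left mult_ac)
  then have "inner_m (u i) (u j) = (if i = j then 1 else 0)" if "i \<le> n" "j \<le> n" for i j
    using orth[of i j] norm_pos[of i] that by (auto simp: c_def)
  moreover have "L (u i) x = lam i * u i x" if "i \<le> n" "x \<le> n" for i x
  proof -
    have "L (u i) x = c i * L (f i) x" by (simp add: L_def u_def algebra_simps)
    then show ?thesis using eig[OF that] by (simp add: u_def)
  qed
  ultimately show ?thesis using mono by blast
qed

end

section \<open>Spectral representation\<close>

text \<open>Eigenvalues \<open>lam 0 < \<dots> < lam n\<close> of \<open>L\<close> with an orthonormal eigenbasis of \<open>l2(m)\<close>.\<close>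

locale birth_death_spectrum = reversible_birth_death +
  fixes lam :: "nat \<Rightarrow> real" and u :: "nat \<Rightarrow> nat \<Rightarrow> real"
  assumes lam_mono: "strict_mono_on {..n} lam"
    and L_u: "i \<le> n \<Longrightarrow> x \<le> n \<Longrightarrow> L (u i) x = lam i * u i x"
    and u_orthonormal: "i \<le> n \<Longrightarrow> j \<le> n \<Longrightarrow> inner_m (u i) (u j) = (if i = j then 1 else 0)"
begin

lemma lam_less: "i < j \<Longrightarrow> j \<le> n \<Longrightarrow> lam i < lam j"
  using lam_mono by (auto simp: monotone_on_def)

text \<open>For square matrices a left inverse is a right inverse, so orthonormality of the rows \<open>u i\<close> gives
  the resolution of the identity.\<close>

lemma u_complete:
  assumes "x \<le> n" "y \<le> n"
  shows "(\<Sum>i\<le>n. u i x * u i y * m y) = (if x = y then 1 else 0)"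
proof -
  define U where "U = mat (Suc n) (Suc n) (\<lambda>(i, x). u i x)"
  define V where "V = mat (Suc n) (Suc n) (\<lambda>(x, i). m x * u i x)"
  have dims: "U \<in> carrier_mat (Suc n) (Suc n)" "V \<in> carrier_mat (Suc n) (Suc n)"
    by (auto simp: U_def V_def)
  have "U * V = 1\<^sub>m (Suc n)"
  proof (rule eq_matI)
    fix i j assume "i < dim_row (1\<^sub>m (Suc n))" "j < dim_col (1\<^sub>m (Suc n))"
    then have ij: "i \<le> n" "j \<le> n" by auto
    have "(U * V) $$ (i, j) = (\<Sum>x<Suc n. u i x * (m x * u j x))"
      using ij by (simp add: U_def V_def scalar_prod_def lessThan_atLeast0)
    also have "\<dots> = inner_m (u i) (u j)"
      by (simp add: inner_m_def lessThan_Suc_atMost mult_ac)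
    finally show "(U * V) $$ (i, j) = 1\<^sub>m (Suc n) $$ (i, j)"
      using ij by (simp add: u_orthonormal)
  qed (auto simp: U_def V_def)
  then have "(V * U) $$ (y, x) = (1\<^sub>m (Suc n) :: real mat) $$ (y, x)"
    using mat_mult_left_right_inverse[OF dims] by simp
  moreover have "(V * U) $$ (y, x) = (\<Sum>i<Suc n. m y * u i y * u i x)"
    using assms by (simp add: U_def V_def scalar_prod_def lessThan_atLeast0)
  ultimately show ?thesis
    using assms by (auto simp: lessThan_Suc_atMost mult_ac)
qed

lemma eigen_expansion:
  assumes "x \<le> n"
  shows "f x = (\<Sum>i\<le>n. inner_m f (u i) * u i x)"
proof -
  have "(\<Sum>i\<le>n. inner_m f (u i) * u i x) = (\<Sum>i\<le>n. \<Sum>y\<le>n. f y * (u i x * u i y * m y))"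
    by (simp add: inner_m_def sum_distrib_left sum_distrib_right mult_ac)
  also have "\<dots> = (\<Sum>y\<le>n. f y * (\<Sum>i\<le>n. u i x * u i y * m y))"
    by (subst sum.swap) (simp add: sum_distrib_left)
  also have "\<dots> = (\<Sum>y\<le>n. if x = y then f y else 0)"
    using assms by (intro sum.cong) (auto simp: u_complete)
  also have "\<dots> = f x" using assms by simp
  finally show ?thesis by simp
qed

lemma inner_m_cong: "(\<And>x. x \<le> n \<Longrightarrow> g x = h x) \<Longrightarrow> inner_m f g = inner_m f h"
  unfolding inner_m_def by (intro sum.cong) auto

lemma inner_m_parseval: "inner_m f g = (\<Sum>i\<le>n. inner_m f (u i) * inner_m g (u i))"
proof -
  have "inner_m f g = inner_m f (\<lambda>x. \<Sum>i\<le>n. inner_m g (u i) * u i x)"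
    by (intro inner_m_cong eigen_expansion)
  also have "\<dots> = (\<Sum>i\<le>n. inner_m g (u i) * inner_m f (u i))"
    by (rule inner_m_sum_right)
  finally show ?thesis by (simp only: mult.commute)
qed

lemma inner_m_L_u: "i \<le> n \<Longrightarrow> inner_m f (L (u i)) = lam i * inner_m f (u i)"
  unfolding inner_m_def sum_distrib_left by (intro sum.cong) (auto simp: L_u)

lemma inner_m_L_spectral: "inner_m f (L f) = (\<Sum>i\<le>n. lam i * (inner_m f (u i))\<^sup>2)"
proof -
  have "inner_m f (L f) = (\<Sum>i\<le>n. inner_m f (u i) * inner_m f (L (u i)))"
    by (subst inner_m_parseval) (simp add: L_symmetric)
  also have "\<dots> = (\<Sum>i\<le>n. lam i * (inner_m f (u i))\<^sup>2)"
    by (intro sum.cong) (auto simp: inner_m_L_u power2_eq_square)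
  finally show ?thesis .
qed

lemma lam_nonneg: "i \<le> n \<Longrightarrow> 0 \<le> lam i"
proof -
  assume i: "i \<le> n"
  have "lam i = inner_m (u i) (L (u i))" using i by (simp add: inner_m_L_u u_orthonormal)
  also have "\<dots> \<ge> 0" unfolding inner_m_L_eq_dirichlet_form
    by (intro sum_nonneg) (auto simp: mult.assoc m_pos b_nonneg less_imp_le)
  finally show ?thesis by simp
qed

text \<open>\<open>L\<close> annihilates the constant function, which is therefore orthogonal to every \<open>u i\<close> with nonzero
  eigenvalue. As it cannot be orthogonal to all of them, \<open>0\<close> is an eigenvalue, hence the smallest one,
  and \<open>u 0\<close> is constant with value \<open>1\<close> or \<open>- 1\<close>, the weights \<open>m\<close> having total mass one.\<close>

lemma constants_in_kernel:
  shows lam_0: "lam 0 = 0"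
    and lam_pos: "0 < i \<Longrightarrow> i \<le> n \<Longrightarrow> 0 < lam i"
    and u_0_mult: "x \<le> n \<Longrightarrow> y \<le> n \<Longrightarrow> u 0 x * u 0 y = 1"
proof -
  define c where "c i = inner_m (\<lambda>_. 1) (u i)" for i
  have ker: "lam i * c i = 0" if "i \<le> n" for i
  proof -
    have "lam i * c i = inner_m (\<lambda>_. 1) (L (u i))" using that by (simp add: c_def inner_m_L_u)
    also have "\<dots> = 0" by (simp add: inner_m_L_eq_dirichlet_form)
    finally show ?thesis .
  qed
  have one: "1 = (\<Sum>i\<le>n. c i * u i x)" if "x \<le> n" for x
    using eigen_expansion[OF that, of "\<lambda>_. 1"] by (simp add: c_def)
  obtain k where k: "k \<le> n" "c k \<noteq> 0"
  proof (rule ccontr)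
    assume "\<not> thesis"
    then have "\<forall>i\<le>n. c i = 0" using that by blast
    then show False using one[of 0] by simp
  qed
  have "lam k = 0" using ker[of k] k by simp
  then have "k = 0" using lam_less[of 0 k] lam_nonneg[of 0] k by (cases k) auto
  then show l0: "lam 0 = 0" using \<open>lam k = 0\<close> by simp
  show lp: "0 < lam i" if "0 < i" "i \<le> n" for i
    using lam_less[OF that] l0 by simp
  have c0: "c i = 0" if "0 < i" "i \<le> n" for i using ker[of i] lp[OF that] that by simp
  have single: "(\<Sum>i\<le>n. c i * g i) = c 0 * g 0" for g
    by (subst sum.mono_neutral_right[of "{..n}" "{0}"]) (auto simp: c0)
  have u0: "c 0 * u 0 x = 1" if "x \<le> n" for x using one[OF that] single by simp
  have "c 0 * c 0 = inner_m (\<lambda>_. 1) (\<lambda>_. 1)"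
    by (subst inner_m_parseval) (simp add: single flip: c_def)
  also have "\<dots> = 1" by (simp add: inner_m_def m_sum)
  finally have cc: "c 0 * c 0 = 1" .
  show "u 0 x * u 0 y = 1" if "x \<le> n" "y \<le> n"
  proof -
    have "(c 0 * c 0) * (u 0 x * u 0 y) = 1"
      using u0[OF that(1)] u0[OF that(2)] by (metis mult.assoc mult.left_commute mult_1_right)
    then show ?thesis using cc by simp
  qed
qed

text \<open>The \<open>n + 1\<close> distinct numbers \<open>lam i\<close> are roots of a monic polynomial of degree \<open>n + 1\<close>, so they are
  all its roots and all simple.\<close>

lemma neg_eigenvalues_gen_mat: "neg_eigenvalues gen_mat = map lam [0..<Suc n]"
proof -
  let ?A = "- gen_mat"
  have A: "?A \<in> carrier_mat (Suc n) (Suc n)" by simp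
  have root: "poly (char_poly ?A) (lam i) = 0" if i: "i \<le> n" for i
  proof -
    let ?v = "vec (Suc n) (u i)"
    have "?v \<noteq> 0\<^sub>v (Suc n)"
    proof
      assume z: "?v = 0\<^sub>v (Suc n)"
      have "u i x = 0" if "x \<le> n" for x
        using arg_cong[OF z, of "\<lambda>v. v $ x"] that by simp
      then have "inner_m (u i) (u i) = 0" by (simp add: inner_m_def)
      then show False using i by (simp add: u_orthonormal)
    qed
    moreover have "?A *\<^sub>v ?v = lam i \<cdot>\<^sub>v ?v"
    proof (rule eq_vecI)
      fix x assume "x < dim_vec (lam i \<cdot>\<^sub>v ?v)"
      then have x: "x \<le> n" by simp
      have "(?A *\<^sub>v ?v) $ x = (\<Sum>y<Suc n. - (gen_mat $$ (x, y)) * u i y)"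
        using x by (auto simp: scalar_prod_def lessThan_atLeast0 simp flip: sum_negf)
      also have "\<dots> = lam i * u i x"
        using gen_mat_apply[OF x, of "u i"] L_u[OF i x]
        by (simp add: lessThan_Suc_atMost sum_negf)
      finally show "(?A *\<^sub>v ?v) $ x = (lam i \<cdot>\<^sub>v ?v) $ x" using x by simp
    qed simp
    ultimately have "eigenvalue ?A (lam i)"
      unfolding eigenvalue_def eigenvector_def by (intro exI[of _ ?v]) simp
    then show ?thesis using eigenvalue_root_char_poly[OF A] by simp
  qed
  have "char_poly ?A = (\<Prod>i<Suc n. [:- lam i, 1:])"
    using degree_monic_char_poly[OF A] root strict_mono_on_imp_inj_on[OF lam_mono]
    by (intro monic_poly_eq_prod_roots) (auto simp: lessThan_Suc_atMost)
  then have "proots (char_poly ?A) = (\<Sum>i<Suc n. {#lam i#})"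
    by (simp only: proots_prod pCons_eq_0_iff one_neq_zero simp_thms finite_lessThan proots_linear_factor minus_minus)
  also have "\<dots> = mset (map lam [0..<Suc n])"
    by (induction n) (auto simp: lessThan_Suc)
  finally have "proots (char_poly ?A) = mset (map lam [0..<Suc n])" .
  moreover have "sorted (map lam [0..<Suc n])"
    unfolding sorted_iff_nth_mono_less using lam_less by (auto simp: less_imp_le simp del: upt_Suc)
  ultimately show ?thesis
    unfolding neg_eigenvalues_def by (simp only: sorted_list_of_multiset_mset sorted_sort_id)
qed

text \<open>Multiplying by \<open>gen_mat\<close> from the right lets it act on row vectors; reversibility converts this into
  the action of \<open>L\<close> on the functions \<open>u i\<close>.\<close>

lemma pow_gen_mat:
  assumes "x \<le> n" "y \<le> n"
  shows "((t \<cdot>\<^sub>m gen_mat) ^\<^sub>m k) $$ (x, y) = (\<Sum>i\<le>n. (- (t * lam i)) ^ k * (u i x * u i y * m y))"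
  using assms(2)
proof (induction k arbitrary: y)
  case 0
  then show ?case using assms by (simp add: u_complete)
next
  case (Suc k)
  let ?P = "(t \<cdot>\<^sub>m gen_mat) ^\<^sub>m k"
  have P: "?P \<in> carrier_mat (Suc n) (Suc n)" by (intro pow_carrier_mat) simp
  have "((t \<cdot>\<^sub>m gen_mat) ^\<^sub>m Suc k) $$ (x, y) = (\<Sum>z<Suc n. ?P $$ (x, z) * (t * gen_mat $$ (z, y)))"
    using assms Suc.prems P by (auto simp: scalar_prod_def lessThan_atLeast0 intro!: sum.cong)
  also have "\<dots> = (\<Sum>z\<le>n. \<Sum>i\<le>n. (- (t * lam i)) ^ k * u i x * t * u i z * (m z * gen_mat $$ (z, y)))"
    unfolding lessThan_Suc_atMost
    by (intro sum.cong) (auto simp: Suc.IH sum_distrib_left sum_distrib_right mult_ac)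
  also have "\<dots> = (\<Sum>z\<le>n. \<Sum>i\<le>n. (- (t * lam i)) ^ k * u i x * t * u i z * (m y * gen_mat $$ (y, z)))"
    using Suc.prems by (intro sum.cong) (auto simp: gen_mat_reversible)
  also have "\<dots> = (\<Sum>i\<le>n. (- (t * lam i)) ^ k * u i x * t * m y * (\<Sum>z\<le>n. gen_mat $$ (y, z) * u i z))"
    by (subst sum.swap) (simp add: sum_distrib_left mult_ac)
  also have "\<dots> = (\<Sum>i\<le>n. (- (t * lam i)) ^ Suc k * (u i x * u i y * m y))"
    using Suc.prems by (intro sum.cong) (auto simp: gen_mat_apply L_u)
  finally show ?case .
qed

lemma mat_exp_gen_mat:
  assumes "x \<le> n" "y \<le> n"
  shows "mat_exp (t \<cdot>\<^sub>m gen_mat) $$ (x, y) = (\<Sum>i\<le>n. exp (- (t * lam i)) * (u i x * u i y * m y))"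
proof -
  have "(\<lambda>k. \<Sum>i\<le>n. (- (t * lam i)) ^ k /\<^sub>R fact k * (u i x * u i y * m y)) sums
        (\<Sum>i\<le>n. exp (- (t * lam i)) * (u i x * u i y * m y))"
    by (intro sums_sum sums_mult2 exp_converges)
  moreover have "(\<lambda>k. \<Sum>i\<le>n. (- (t * lam i)) ^ k /\<^sub>R fact k * (u i x * u i y * m y))
      = (\<lambda>k. ((t \<cdot>\<^sub>m gen_mat) ^\<^sub>m k) $$ (x, y) / fact k)"
    by (simp add: pow_gen_mat[OF assms] sum_distrib_left divide_inverse mult_ac)
  ultimately show ?thesis using assms by (simp add: mat_exp_def sums_iff)
qed

text \<open>The difference of the two sides is a combination of the decrements of \<open>g\<close> at \<open>x - 1\<close>, \<open>x\<close> and
  \<open>x + 1\<close> with coefficients \<open>d x\<close>, \<open>c - b x - d (Suc x)\<close> and \<open>b (Suc x)\<close>; the shift by \<open>c\<close> makes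
  the middle one nonnegative.\<close>

lemma shifted_L_preserves_decreasing:
  assumes c: "\<And>x. x < n \<Longrightarrow> b x + d (Suc x) \<le> c"
    and dec: "\<And>x. x < n \<Longrightarrow> g (Suc x) \<le> g x"
    and "x < n"
  shows "c * g (Suc x) - L g (Suc x) \<le> c * g x - L g x"
proof -
  have 1: "0 \<le> (c - b x - d (Suc x)) * (g x - g (Suc x))"
    using c dec \<open>x < n\<close> by (intro mult_nonneg_nonneg) (auto simp: algebra_simps)
  have 2: "0 \<le> d x * (g (x - 1) - g x)"
    using d_nonneg[of x] dec[of "x - 1"] \<open>x < n\<close> by (cases x) auto
  have 3: "0 \<le> b (Suc x) * (g (Suc x) - g (Suc (Suc x)))"
    using b_nonneg[of "Suc x"] b_n dec[of "Suc x"] \<open>x < n\<close> by (cases "Suc x = n") auto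
  show ?thesis using 1 2 3 by (simp add: L_def algebra_simps)
qed

text \<open>Write \<open>exp (- t L) = exp (- t c) exp (t (c - L))\<close>. By reversibility the ratio in question is
  \<open>exp (- t L)\<close> applied to the point mass at \<open>0\<close> divided by \<open>m 0\<close>. That function is decreasing,
  every power of \<open>c - L\<close> keeps it decreasing, and so does the exponential series with its nonnegative
  coefficients.\<close>

lemma mat_exp_ratio_decreasing:
  assumes "0 \<le> t" "x < n"
  shows "mat_exp (t \<cdot>\<^sub>m gen_mat) $$ (0, Suc x) / m (Suc x) \<le> mat_exp (t \<cdot>\<^sub>m gen_mat) $$ (0, x) / m x"
proof -
  \<comment> \<open>Any common bound of the numbers \<open>b x + d (Suc x)\<close> would do.\<close>
  define c where "c = (\<Sum>x<n. b x + d (Suc x))"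
  have c: "b x + d (Suc x) \<le> c" if "x < n" for x
    unfolding c_def using that b_pos d_pos
    by (intro member_le_sum) (auto simp: less_imp_le add_nonneg_nonneg)
  \<comment> \<open>\<open>h k\<close> is the \<open>k\<close>-th power of \<open>c - L\<close> applied to the normalised point mass at \<open>0\<close>.\<close>
  define h where "h k x = (\<Sum>i\<le>n. (c - lam i) ^ k * u i 0 * u i x)" for k x
  have h_Suc: "h (Suc k) x = c * h k x - L (h k) x" if "x \<le> n" for k x
  proof -
    have "L (h k) x = (\<Sum>i\<le>n. (c - lam i) ^ k * u i 0 * L (u i) x)"
      unfolding h_def by (rule L_sum)
    also have "\<dots> = (\<Sum>i\<le>n. (c - lam i) ^ k * u i 0 * (lam i * u i x))"
      using that by (intro sum.cong) (auto simp: L_u)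
    finally show ?thesis
      by (simp add: h_def sum_distrib_left algebra_simps flip: sum_subtractf)
  qed
  have h_dec: "h k (Suc x) \<le> h k x" if "x < n" for k x
    using that
  proof (induction k arbitrary: x)
    case 0
    have "h 0 y = (if y = 0 then 1 else 0) / m y" if "y \<le> n" for y
      using u_complete[of 0 y] m_pos[OF that] that
      by (auto simp: h_def field_simps simp flip: sum_distrib_left sum_distrib_right)
    then show ?case using 0 m_pos[of 0] by auto
  next
    case (Suc k)
    show ?case using Suc.prems
      by (simp add: h_Suc) (intro shifted_L_preserves_decreasing c Suc.IH)
  qed
  have ratio: "(\<lambda>k. exp (- (t * c)) * (t ^ k / fact k * h k y)) sums (mat_exp (t \<cdot>\<^sub>m gen_mat) $$ (0, y) / m y)"
    if "y \<le> n" for y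
  proof -
    have "(\<lambda>k. exp (- (t * c)) * (\<Sum>i\<le>n. (t * (c - lam i)) ^ k /\<^sub>R fact k * (u i 0 * u i y))) sums
        (exp (- (t * c)) * (\<Sum>i\<le>n. exp (t * (c - lam i)) * (u i 0 * u i y)))"
      by (intro sums_mult sums_sum sums_mult2 exp_converges)
    also have "(\<lambda>k. exp (- (t * c)) * (\<Sum>i\<le>n. (t * (c - lam i)) ^ k /\<^sub>R fact k * (u i 0 * u i y)))
       = (\<lambda>k. exp (- (t * c)) * (t ^ k / fact k * h k y))"
      by (simp add: h_def sum_distrib_left power_mult_distrib divide_inverse mult_ac)
    also have "exp (- (t * c)) * (\<Sum>i\<le>n. exp (t * (c - lam i)) * (u i 0 * u i y))
       = (\<Sum>i\<le>n. exp (- (t * lam i)) * (u i 0 * u i y))"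
      unfolding sum_distrib_left mult.assoc[symmetric] exp_add[symmetric]
      by (simp add: algebra_simps)
    also have "\<dots> = mat_exp (t \<cdot>\<^sub>m gen_mat) $$ (0, y) / m y"
      using that m_pos[OF that] by (simp add: mat_exp_gen_mat sum_divide_distrib)
    finally show ?thesis .
  qed
  show ?thesis
    by (rule sums_le[OF _ ratio ratio])
       (use assms in \<open>auto intro!: mult_left_mono divide_right_mono h_dec simp: times_divide_eq_left[symmetric] simp del: times_divide_eq_left\<close>)
qed

end

section \<open>Comparison of eigenvalues\<close>

text \<open>Padding the \<open>i\<close> equations in \<open>i + 1\<close> unknowns with a zero row gives a singular square matrix.\<close>

lemma underdetermined_system_nontrivial_solution:
  fixes A :: "nat \<Rightarrow> nat \<Rightarrow> real"
  shows "\<exists>c. (\<exists>j\<le>i. c j \<noteq> 0) \<and> (\<forall>k<i. (\<Sum>j\<le>i. A k j * c j) = 0)"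
proof -
  let ?A = "mat (Suc i) (Suc i) (\<lambda>(k, j). if k < i then A k j else 0)"
  have A: "?A \<in> carrier_mat (Suc i) (Suc i)" by simp
  have "det ?A = 0" using laplace_expansion_row[OF A, of i] by simp
  then obtain v where v: "v \<in> carrier_vec (Suc i)" "v \<noteq> 0\<^sub>v (Suc i)" "?A *\<^sub>v v = 0\<^sub>v (Suc i)"
    using det_0_iff_vec_prod_zero[OF A] by blast
  have "\<exists>j\<le>i. v $ j \<noteq> 0"
  proof (rule ccontr)
    assume "\<not> (\<exists>j\<le>i. v $ j \<noteq> 0)"
    then have "v = 0\<^sub>v (Suc i)" using v(1) by (intro eq_vecI) auto
    then show False using v(2) by simp
  qed
  moreover have "(\<Sum>j\<le>i. A k j * v $ j) = 0" if "k < i" for k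
  proof -
    have "(?A *\<^sub>v v) $ k = (\<Sum>j<Suc i. A k j * v $ j)"
      using that v(1) by (auto simp: scalar_prod_def lessThan_atLeast0 intro!: sum.cong)
    then show ?thesis using v(3) that by (simp add: lessThan_Suc_atMost)
  qed
  ultimately show ?thesis by (intro exI[of _ "\<lambda>j. v $ j"]) blast
qed

text \<open>The Courant-Fischer argument. The span of the first \<open>i + 1\<close> eigenfunctions of the second chain
  contains some \<open>f \<noteq> 0\<close> orthogonal to the first \<open>i\<close> eigenfunctions of the first chain. Its Rayleigh
  quotient is at least \<open>lam i\<close> for the first chain and at most \<open>lam' i\<close> for the second, while the
  Dirichlet form of the first chain is the smaller one.\<close>

lemma eigenvalues_mono_in_rates:
  assumes S: "birth_death_spectrum n m b d lam u" and S': "birth_death_spectrum n m b' d' lam' u'"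
    and rates: "\<And>x. x < n \<Longrightarrow> b x \<le> b' x" and i: "i \<le> n"
  shows "lam i \<le> lam' i"
proof -
  interpret S: birth_death_spectrum n m b d lam u by fact
  interpret S': birth_death_spectrum n m b' d' lam' u' by fact
  obtain c where c: "\<exists>j\<le>i. c j \<noteq> 0" "\<And>k. k < i \<Longrightarrow> (\<Sum>j\<le>i. S.inner_m (u k) (u' j) * c j) = 0"
    using underdetermined_system_nontrivial_solution[of i "\<lambda>k j. S.inner_m (u k) (u' j)"] by blast
  define f where "f x = (\<Sum>j\<le>i. c j * u' j x)" for x
  have f: "f = (\<lambda>x. \<Sum>j\<le>i. c j * u' j x)" by (simp add: f_def fun_eq_iff)
  have coeff: "S.inner_m f (u k) = 0" if "k < i" for k
    using c(2)[OF that] unfolding f by (subst S.inner_m_commute) (simp add: S.inner_m_sum_right mult.commute)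
  have coeff': "S.inner_m f (u' k) = (if k \<le> i then c k else 0)" if "k \<le> n" for k
  proof -
    have "S.inner_m f (u' k) = (\<Sum>j\<le>i. c j * S.inner_m (u' k) (u' j))"
      unfolding f by (subst S.inner_m_commute) (rule S.inner_m_sum_right)
    also have "\<dots> = (\<Sum>j\<le>i. if k = j then c j else 0)"
      using that i by (intro sum.cong) (auto simp: S'.u_orthonormal)
    finally show ?thesis by simp
  qed
  define N where "N = S.inner_m f f"
  have "N = (\<Sum>k\<le>n. (if k \<le> i then c k else 0)\<^sup>2)"
    unfolding N_def by (subst S'.inner_m_parseval) (auto simp: coeff' power2_eq_square intro!: sum.cong)
  moreover have "0 < (\<Sum>k\<le>n. (if k \<le> i then c k else 0)\<^sup>2)"
  proof -
    obtain j where "j \<le> i" "c j \<noteq> 0" using c(1) by blast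
    then show ?thesis using i by (intro sum_pos2[of _ j]) auto
  qed
  ultimately have "0 < N" by simp
  have "lam i * N = (\<Sum>k\<le>n. lam i * (S.inner_m f (u k))\<^sup>2)"
    unfolding N_def by (subst S.inner_m_parseval) (simp add: sum_distrib_left power2_eq_square)
  also have "\<dots> \<le> S.inner_m f (S.L f)"
    unfolding S.inner_m_L_spectral
  proof (rule sum_mono)
    fix k assume "k \<in> {..n}"
    then show "lam i * (S.inner_m f (u k))\<^sup>2 \<le> lam k * (S.inner_m f (u k))\<^sup>2"
      using coeff[of k] S.lam_less[of i k] by (cases k i rule: linorder_cases) (auto intro: mult_right_mono)
  qed
  also have "\<dots> \<le> S.inner_m f (S'.L f)"
    unfolding S.inner_m_L_eq_dirichlet_form S'.inner_m_L_eq_dirichlet_form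
    using rates S.m_pos
    by (intro sum_mono) (auto simp: mult.assoc less_imp_le intro!: mult_left_mono mult_right_mono)
  also have "\<dots> \<le> (\<Sum>k\<le>n. lam' i * (S.inner_m f (u' k))\<^sup>2)"
    unfolding S'.inner_m_L_spectral
  proof (rule sum_mono)
    fix k assume "k \<in> {..n}"
    then show "lam' k * (S.inner_m f (u' k))\<^sup>2 \<le> lam' i * (S.inner_m f (u' k))\<^sup>2"
      using coeff'[of k] S'.lam_less[of k i] i by (cases k i rule: linorder_cases) (auto intro: mult_right_mono)
  qed
  also have "\<dots> = lam' i * N"
    unfolding N_def by (subst (2) S'.inner_m_parseval) (simp add: sum_distrib_left power2_eq_square)
  finally show ?thesis using \<open>0 < N\<close> by simp
qed

section \<open>The spectral weights between the two end states\<close>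

text \<open>Both sides are polynomials in \<open>z\<close> of degree less than \<open>card I\<close> that agree at the nodes \<open>r i\<close>.\<close>

lemma lagrange_interpolation_of_one:
  fixes r :: "nat \<Rightarrow> real"
  assumes "finite I" "inj_on r I" "I \<noteq> {}"
  shows "(\<Sum>i\<in>I. \<Prod>j\<in>I - {i}. (z - r j) / (r i - r j)) = 1"
proof -
  define p where "p i = (\<Prod>j\<in>I - {i}. Polynomial.smult (1 / (r i - r j)) [:- r j, 1:])" for i
  have poly_p: "poly (p i) y = (\<Prod>j\<in>I - {i}. (y - r j) / (r i - r j))" for i y
    by (simp add: p_def poly_prod diff_divide_distrib)
  have "(\<Sum>i\<in>I. p i) = 1"
  proof (rule poly_eqI_degree)
    fix y assume "y \<in> r ` I"
    then obtain k where k: "k \<in> I" "y = r k" by blast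
    have "poly (p i) y = (if i = k then 1 else 0)" if "i \<in> I" for i
    proof (cases "i = k")
      case True
      have "r k \<noteq> r j" if "j \<in> I - {k}" for j using assms(2) k that by (auto simp: inj_on_def)
      then show ?thesis using True k by (auto simp: poly_p intro!: prod.neutral)
    next
      case False
      then show ?thesis using k assms(1) by (auto simp: poly_p intro!: prod_zero)
    qed
    then show "poly (\<Sum>i\<in>I. p i) y = poly 1 y"
      using assms(1) k by (simp add: poly_sum)
  next
    have card: "card (r ` I) = card I" using assms(2) by (rule card_image)
    have pos: "0 < card I" using assms by (simp add: card_gt_0_iff)
    have "degree (p i) < card I" if "i \<in> I" for i
    proof -
      have "degree (p i) \<le> (\<Sum>j\<in>I - {i}. degree (Polynomial.smult (1 / (r i - r j)) [:- r j, 1:]))"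
        unfolding p_def by (rule degree_prod_sum_le[unfolded o_def]) (use assms in auto)
      also have "\<dots> \<le> (\<Sum>j\<in>I - {i}. 1)"
        by (intro sum_mono order_trans[OF degree_smult_le]) auto
      also have "\<dots> < card I" using that assms by (simp add: card_gt_0_iff)
      finally show ?thesis .
    qed
    then show "degree (\<Sum>i\<in>I. p i) < card (r ` I)"
      unfolding card using pos by (intro degree_sum_less) auto
    show "degree (1 :: real poly) < card (r ` I)" unfolding card using pos by simp
  qed
  then have "poly (\<Sum>i\<in>I. p i) z = 1" by simp
  then show ?thesis by (simp add: poly_sum poly_p)
qed

lemma DERIV_prod_resolvent:
  fixes r :: "nat \<Rightarrow> real"
  assumes "finite I" "\<And>j. j \<in> I \<Longrightarrow> \<alpha> + r j \<noteq> 0"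
  shows "((\<lambda>\<alpha>. \<Prod>j\<in>I. r j / (\<alpha> + r j)) has_real_derivative
     - (\<Prod>j\<in>I. r j / (\<alpha> + r j)) * (\<Sum>j\<in>I. 1 / (\<alpha> + r j))) (at \<alpha>)"
  using assms
proof (induction I)
  case (insert i I)
  have "((\<lambda>\<alpha>. r i / (\<alpha> + r i)) has_real_derivative - (r i / (\<alpha> + r i)) * (1 / (\<alpha> + r i))) (at \<alpha>)"
    using insert.prems by (auto intro!: derivative_eq_intros simp: field_simps)
  note deriv = DERIV_mult[OF this insert.IH]
  have eq: "- c * e * P + - P * S * c = - (c * P) * (e + S)" for c e P S :: real
    by (simp add: algebra_simps)
  show ?case
    using deriv[unfolded eq] insert by (simp only: prod.insert sum.insert simp_thms insert_iff)
qed simp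

context birth_death_spectrum
begin

text \<open>The coefficient of \<open>exp (- lam i * t)\<close> in the spectral expansion of
  \<open>mat_exp (t \<cdot>\<^sub>m gen_mat) $$ (0, n) / m n\<close>.\<close>

definition w :: "nat \<Rightarrow> real" where "w i = u i 0 * u i n"

text \<open>The sum is, up to the factor \<open>m n\<close>, the \<open>(x, n)\<close> entry of the \<open>k\<close>-th power of a tridiagonal
  matrix, and \<open>n\<close> cannot be reached from \<open>x\<close> in \<open>k < n - x\<close> steps.\<close>

lemma power_sums_vanish:
  assumes "x + k < n"
  shows "(\<Sum>i\<le>n. lam i ^ k * u i x * u i n) = 0"
  using assms
proof (induction k arbitrary: x)
  case 0
  have "(\<Sum>i\<le>n. u i x * u i n) * m n = 0"
    using 0 u_complete[of x n] by (simp add: sum_distrib_right)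
  then show ?case using m_pos[of n] by simp
next
  case (Suc k)
  have "(\<Sum>i\<le>n. lam i ^ Suc k * u i x * u i n) = (\<Sum>i\<le>n. lam i ^ k * u i n * L (u i) x)"
    using Suc.prems by (intro sum.cong) (auto simp: L_u)
  also have "\<dots> = L (\<lambda>x. \<Sum>i\<le>n. lam i ^ k * u i n * u i x) x"
    by (rule L_sum[symmetric])
  also have "\<dots> = 0"
    using Suc.IH[of x] Suc.IH[of "Suc x"] Suc.IH[of "x - 1"] Suc.prems
    by (simp add: L_def mult.assoc mult.commute[of "u _ n"])
  finally show ?case .
qed

lemma w_annihilates_low_degree:
  assumes "degree q < n"
  shows "(\<Sum>i\<le>n. w i * poly q (lam i)) = 0"
proof -
  have "(\<Sum>i\<le>n. w i * poly q (lam i)) = (\<Sum>i\<le>n. \<Sum>k\<le>degree q. coeff q k * (lam i ^ k * u i 0 * u i n))"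
    by (simp add: poly_altdef w_def sum_distrib_left mult_ac)
  also have "\<dots> = (\<Sum>k\<le>degree q. coeff q k * (\<Sum>i\<le>n. lam i ^ k * u i 0 * u i n))"
    by (subst sum.swap) (simp add: sum_distrib_left)
  also have "\<dots> = 0"
    using assms by (intro sum.neutral) (auto simp: power_sums_vanish)
  finally show ?thesis .
qed

lemma w_0: "w 0 = 1"
  unfolding w_def by (intro u_0_mult) auto

text \<open>A linear functional on functions of \<open>lam 0, \<dots>, lam n\<close> that annihilates the polynomials of degree
  below \<open>n\<close> is a multiple of the divided difference, so \<open>w i\<close> times the product of the differences
  does not depend on \<open>i\<close>. Testing against the polynomial with roots \<open>lam j\<close>, \<open>j \<noteq> 0, i\<close> compares the
  value at \<open>i\<close> with the value at \<open>0\<close>, which is known because \<open>w 0 = 1\<close>. In particular the weights are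
  functions of the eigenvalues alone.\<close>

lemma w_mult_prod_diff:
  assumes "i \<le> n"
  shows "w i * (\<Prod>j\<in>{..n} - {i}. lam i - lam j) = (\<Prod>j=1..n. - lam j)"
proof (cases "i = 0")
  case True
  have "{..n} - {0} = {1..n}" by auto
  then show ?thesis using True by (simp add: w_0 lam_0)
next
  case False
  define q where "q = (\<Prod>j\<in>{1..n} - {i}. [:- lam j, 1:])"
  have q: "poly q y = (\<Prod>j\<in>{1..n} - {i}. y - lam j)" for y
    by (simp add: q_def poly_prod)
  have "degree q = card ({1..n} - {i})"
    unfolding q_def by (subst degree_prod_eq_sum_degree) auto
  also have "\<dots> < n" using False assms by simp
  finally have "0 = (\<Sum>k\<le>n. w k * poly q (lam k))" by (simp add: w_annihilates_low_degree)
  also have "\<dots> = (\<Sum>k\<in>{0, i}. w k * poly q (lam k))"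
    using assms by (intro sum.mono_neutral_right) (auto simp: q)
  also have "\<dots> = poly q 0 + w i * poly q (lam i)" using False by (simp add: w_0 lam_0)
  finally have *: "w i * poly q (lam i) = - poly q 0" by simp
  have "{..n} - {i} = insert 0 ({1..n} - {i})" using False by auto
  then have "w i * (\<Prod>j\<in>{..n} - {i}. lam i - lam j) = lam i * (w i * poly q (lam i))"
    by (simp add: q lam_0)
  also have "\<dots> = - lam i * poly q 0" using * by simp
  also have "\<dots> = (\<Prod>j=1..n. - lam j)"
    using False assms prod.remove[of "{1..n}" i "\<lambda>j. - lam j"] by (simp add: q)
  finally show ?thesis .
qed

lemma lam_nonzero: "j \<in> {1..n} \<Longrightarrow> lam j \<noteq> 0"
  using lam_pos[of j] by auto

text \<open>Insert the formula for \<open>w i\<close> and recognise Lagrange interpolation at the point \<open>- \<alpha>\<close>. For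
  \<open>\<alpha> > 0\<close> this is the Laplace transform of a sum of independent exponential variables; the
  identity holds on a neighbourhood of \<open>0\<close> as well, so that it can be differentiated there.\<close>

lemma partial_fractions:
  assumes \<alpha>: "\<And>j. j \<in> {1..n} \<Longrightarrow> 0 < \<alpha> + lam j"
  shows "1 + (\<Sum>i=1..n. w i * (\<alpha> / (\<alpha> + lam i))) = (\<Prod>j=1..n. lam j / (\<alpha> + lam j))"
proof (cases "\<alpha> = 0")
  case True
  have "(\<Prod>j=1..n. lam j / (0 + lam j)) = 1"
    by (intro prod.neutral ballI) (simp only: add_0 divide_self[OF lam_nonzero])
  then show ?thesis using True by simp
next
  case False
  have ne: "\<alpha> + lam j \<noteq> 0" if "j \<le> n" for j
    using \<alpha>[of j] that False lam_0 by (cases "j = 0") auto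
  define P where "P = (\<Prod>j\<le>n. \<alpha> + lam j)"
  have P: "P = \<alpha> * (\<Prod>j=1..n. \<alpha> + lam j)"
    unfolding P_def by (simp add: atMost_atLeast0 prod.atLeast_Suc_atMost lam_0)
  have "P \<noteq> 0" unfolding P_def using ne by simp
  have inj: "inj_on lam {..n}" using lam_mono by (rule strict_mono_on_imp_inj_on)
  have summand: "(\<Prod>j\<in>{..n} - {i}. (- \<alpha> - lam j) / (lam i - lam j)) * (\<Prod>j=1..n. lam j)
      = P * (w i / (\<alpha> + lam i))" if i: "i \<le> n" for i
  proof -
    let ?D = "\<Prod>j\<in>{..n} - {i}. lam i - lam j"
    have D: "?D \<noteq> 0" using inj i by (auto simp: inj_on_def)
    have card: "card ({..n} - {i}) = n" using i by simp
    have "(\<Prod>j\<in>{..n} - {i}. (- \<alpha> - lam j) / (lam i - lam j))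
       = (\<Prod>j\<in>{..n} - {i}. (-1) * (\<alpha> + lam j)) / ?D"
      by (simp add: prod_dividef)
    also have "(\<Prod>j\<in>{..n} - {i}. (-1) * (\<alpha> + lam j)) = (-1) ^ n * (\<Prod>j\<in>{..n} - {i}. \<alpha> + lam j)"
      by (simp only: prod.distrib prod_constant card)
    also have "(\<Prod>j\<in>{..n} - {i}. \<alpha> + lam j) = P / (\<alpha> + lam i)"
      unfolding P_def using i ne[OF i] by (subst prod.remove[of "{..n}" i]) auto
    finally have "(\<Prod>j\<in>{..n} - {i}. (- \<alpha> - lam j) / (lam i - lam j)) * (\<Prod>j=1..n. lam j)
      = P / (\<alpha> + lam i) * ((-1) ^ n * (\<Prod>j=1..n. lam j)) / ?D" by simp
    also have "(-1) ^ n * (\<Prod>j=1..n. lam j) = (\<Prod>j=1..n. (-1) * lam j)"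
      by (simp only: prod.distrib prod_constant) simp
    also have "\<dots> = w i * ?D" using w_mult_prod_diff[OF i] by simp
    finally show ?thesis using D by simp
  qed
  have "(\<Prod>j=1..n. lam j) = (\<Sum>i\<le>n. \<Prod>j\<in>{..n} - {i}. (- \<alpha> - lam j) / (lam i - lam j)) * (\<Prod>j=1..n. lam j)"
    using lagrange_interpolation_of_one[of "{..n}" lam "- \<alpha>"] inj by simp
  also have "\<dots> = P * (\<Sum>i\<le>n. w i / (\<alpha> + lam i))"
    unfolding sum_distrib_right sum_distrib_left by (intro sum.cong refl summand) simp
  finally have "(\<Prod>j=1..n. lam j) / (\<Prod>j=1..n. \<alpha> + lam j) = \<alpha> * (\<Sum>i\<le>n. w i / (\<alpha> + lam i))"
    using \<open>P \<noteq> 0\<close> False unfolding P by (simp add: field_simps)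
  also have "\<dots> = 1 + (\<Sum>i=1..n. w i * (\<alpha> / (\<alpha> + lam i)))"
    using False by (simp add: atMost_atLeast0 sum.atLeast_Suc_atMost w_0 lam_0 distrib_left sum_distrib_left mult_ac)
  finally show ?thesis by (simp add: prod_dividef)
qed

text \<open>The first two derivatives at \<open>\<alpha> = 0\<close> of the two sides of the partial fraction expansion. The left
  sides are the first and second moment of the tail with weights \<open>w\<close>, the right sides those of a sum of
  independent exponential variables.\<close>

lemma inverse_power_sums:
  shows "- (\<Sum>i=1..n. w i / lam i) = (\<Sum>i=1..n. 1 / lam i)"
    and "- 2 * (\<Sum>i=1..n. w i / (lam i)\<^sup>2) = (\<Sum>i=1..n. 1 / lam i)\<^sup>2 + (\<Sum>i=1..n. 1 / (lam i)\<^sup>2)"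
proof -
  let ?I = "{1..n}"
  define R where "R \<alpha> = (\<Prod>j\<in>?I. lam j / (\<alpha> + lam j))" for \<alpha>
  \<comment> \<open>An open set rather than just the point \<open>0\<close>, because the first derivative is
    differentiated again.\<close>
  define S where "S = {\<alpha>. \<forall>j\<in>?I. - lam j < \<alpha>}"
  have "S = (\<Inter>j\<in>?I. {- lam j<..})" by (auto simp: S_def)
  then have "open S" by auto
  have S: "0 < \<alpha> + lam j" if "\<alpha> \<in> S" "j \<in> ?I" for \<alpha> j using that by (force simp: S_def)
  have "0 \<in> S" using lam_pos by (auto simp: S_def)
  have d1: "(\<Sum>i\<in>?I. w i * (lam i / (\<alpha> + lam i)\<^sup>2)) = - R \<alpha> * (\<Sum>j\<in>?I. 1 / (\<alpha> + lam j))" if "\<alpha> \<in> S" for \<alpha>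
  proof (rule DERIV_unique)
    show "((\<lambda>\<alpha>. 1 + (\<Sum>i\<in>?I. w i * (\<alpha> / (\<alpha> + lam i)))) has_real_derivative
       - R \<alpha> * (\<Sum>j\<in>?I. 1 / (\<alpha> + lam j))) (at \<alpha>)"
    proof (rule has_field_derivative_transform_within_open[OF _ \<open>open S\<close> that])
      show "(R has_real_derivative - R \<alpha> * (\<Sum>j\<in>?I. 1 / (\<alpha> + lam j))) (at \<alpha>)"
        unfolding R_def using S[OF that] by (intro DERIV_prod_resolvent) force+
      show "R \<beta> = 1 + (\<Sum>i\<in>?I. w i * (\<beta> / (\<beta> + lam i)))" if "\<beta> \<in> S" for \<beta>
        unfolding R_def using S[OF that] by (intro partial_fractions[symmetric])
    qed
    have "((\<lambda>\<alpha>. \<alpha> / (\<alpha> + lam i)) has_real_derivative lam i / (\<alpha> + lam i)\<^sup>2) (at \<alpha>)" if "i \<in> ?I" for i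
      using S[OF \<open>\<alpha> \<in> S\<close> that] by (auto intro!: derivative_eq_intros simp: field_simps power2_eq_square)
    then show "((\<lambda>\<alpha>. 1 + (\<Sum>i\<in>?I. w i * (\<alpha> / (\<alpha> + lam i)))) has_real_derivative
       (\<Sum>i\<in>?I. w i * (lam i / (\<alpha> + lam i)\<^sup>2))) (at \<alpha>)"
      by (intro DERIV_add[of "\<lambda>_. 1" 0, simplified] DERIV_sum DERIV_cmult) auto
  qed
  have R0: "R 0 = 1"
    unfolding R_def by (intro prod.neutral ballI) (simp only: add_0 divide_self[OF lam_nonzero])
  have pos: "0 < lam i" if "i \<in> ?I" for i using lam_pos that by auto
  have "(\<Sum>i\<in>?I. w i / lam i) = (\<Sum>i\<in>?I. w i * (lam i / (0 + lam i)\<^sup>2))"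
    by (intro sum.cong) (auto simp: power2_eq_square)
  also have "\<dots> = - (\<Sum>i\<in>?I. 1 / lam i)" using d1[OF \<open>0 \<in> S\<close>] R0 by simp
  finally show "- (\<Sum>i=1..n. w i / lam i) = (\<Sum>i=1..n. 1 / lam i)" by simp
  have "(\<Sum>i\<in>?I. w i * (- 2 * lam i / (0 + lam i) ^ 3))
     = R 0 * ((\<Sum>j\<in>?I. 1 / (0 + lam j))\<^sup>2 + (\<Sum>j\<in>?I. 1 / (0 + lam j)\<^sup>2))"
  proof (rule DERIV_unique)
    show "((\<lambda>\<alpha>. \<Sum>i\<in>?I. w i * (lam i / (\<alpha> + lam i)\<^sup>2)) has_real_derivative
       R 0 * ((\<Sum>j\<in>?I. 1 / (0 + lam j))\<^sup>2 + (\<Sum>j\<in>?I. 1 / (0 + lam j)\<^sup>2))) (at 0)"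
    proof (rule has_field_derivative_transform_within_open[OF _ \<open>open S\<close> \<open>0 \<in> S\<close>])
      have dR: "(R has_real_derivative - R 0 * (\<Sum>j\<in>?I. 1 / (0 + lam j))) (at 0)"
        unfolding R_def using S[OF \<open>0 \<in> S\<close>] by (intro DERIV_prod_resolvent) force+
      have "((\<lambda>\<alpha>. 1 / (\<alpha> + lam j)) has_real_derivative - (1 / (0 + lam j)\<^sup>2)) (at 0)"
        if "j \<in> ?I" for j
        using lam_nonzero[OF that] by (auto intro!: derivative_eq_intros simp: power2_eq_square)
      then have dS: "((\<lambda>\<alpha>. \<Sum>j\<in>?I. 1 / (\<alpha> + lam j)) has_real_derivative (\<Sum>j\<in>?I. - (1 / (0 + lam j)\<^sup>2))) (at 0)"
        by (intro DERIV_sum)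
      show "((\<lambda>\<alpha>. - R \<alpha> * (\<Sum>j\<in>?I. 1 / (\<alpha> + lam j))) has_real_derivative
         R 0 * ((\<Sum>j\<in>?I. 1 / (0 + lam j))\<^sup>2 + (\<Sum>j\<in>?I. 1 / (0 + lam j)\<^sup>2))) (at 0)"
        by (rule DERIV_cong[OF DERIV_mult[OF DERIV_minus[OF dR] dS]])
           (simp add: sum_negf algebra_simps power2_eq_square)
      show "- R \<alpha> * (\<Sum>j\<in>?I. 1 / (\<alpha> + lam j)) = (\<Sum>i\<in>?I. w i * (lam i / (\<alpha> + lam i)\<^sup>2))" if "\<alpha> \<in> S" for \<alpha>
        using d1[OF that] by simp
    qed
    have "((\<lambda>\<alpha>. lam i / (\<alpha> + lam i)\<^sup>2) has_real_derivative - 2 * lam i / (0 + lam i) ^ 3) (at 0)" if "i \<in> ?I" for i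
      using pos[OF that] by (auto intro!: derivative_eq_intros simp: field_simps power2_eq_square power3_eq_cube)
    then show "((\<lambda>\<alpha>. \<Sum>i\<in>?I. w i * (lam i / (\<alpha> + lam i)\<^sup>2)) has_real_derivative
       (\<Sum>i\<in>?I. w i * (- 2 * lam i / (0 + lam i) ^ 3))) (at 0)"
      by (intro DERIV_sum DERIV_cmult)
  qed
  moreover have "(\<Sum>i\<in>?I. w i * (- 2 * lam i / (0 + lam i) ^ 3)) = - 2 * (\<Sum>i\<in>?I. w i / (lam i)\<^sup>2)"
    unfolding sum_distrib_left using pos
    by (intro sum.cong) (auto simp: power2_eq_square power3_eq_cube field_simps)
  ultimately show "- 2 * (\<Sum>i=1..n. w i / (lam i)\<^sup>2) = (\<Sum>i=1..n. 1 / lam i)\<^sup>2 + (\<Sum>i=1..n. 1 / (lam i)\<^sup>2)"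
    using R0 by simp
qed

text \<open>By monotonicity the maximum is attained at \<open>y = n\<close>, the state opposite to the starting point.\<close>

lemma separation_eq:
  assumes "0 < t"
  shows "(MAX y\<in>{0..n}. 1 - mat_exp (t \<cdot>\<^sub>m gen_mat) $$ (0, y) / m y) = - (\<Sum>i=1..n. w i * exp (- (lam i * t)))"
proof -
  let ?h = "\<lambda>y. mat_exp (t \<cdot>\<^sub>m gen_mat) $$ (0, y) / m y"
  have "?h n \<le> ?h y" if "y \<le> n" for y
    using that
  proof (induction rule: inc_induct)
    case (step k)
    then show ?case using mat_exp_ratio_decreasing[of t k] assms by simp
  qed simp
  then have "(MAX y\<in>{0..n}. 1 - ?h y) = 1 - ?h n"
    by (intro Max_eqI) auto
  also have "?h n = (\<Sum>i\<le>n. w i * exp (- (lam i * t)))"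
    using m_pos[of n] by (simp add: mat_exp_gen_mat w_def sum_divide_distrib mult_ac)
  also have "\<dots> = 1 + (\<Sum>i=1..n. w i * exp (- (lam i * t)))"
    by (simp add: atMost_atLeast0 sum.atLeast_Suc_atMost w_0 lam_0)
  finally show ?thesis by simp
qed

end

section \<open>Moments of a tail that is a combination of exponentials\<close>

text \<open>Tonelli's theorem for \<open>\<Psi> (T \<omega>)\<close> written as the integral of \<open>\<psi>\<close> over \<open>{0..T \<omega>}\<close>.\<close>

lemma (in prob_space) nn_integral_layer_cake:
  fixes T :: "'a \<Rightarrow> real" and \<psi> \<Psi> :: "real \<Rightarrow> real"
  assumes T [measurable]: "T \<in> borel_measurable M" and T_nonneg: "\<And>\<omega>. \<omega> \<in> space M \<Longrightarrow> 0 \<le> T \<omega>"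
    and \<psi> [measurable]: "\<psi> \<in> borel_measurable borel" and \<psi>_nonneg: "\<And>s. 0 \<le> s \<Longrightarrow> 0 \<le> \<psi> s"
    and \<Psi>: "\<And>s. (\<Psi> has_real_derivative \<psi> s) (at s)" "\<Psi> 0 = 0"
  shows "(\<integral>\<^sup>+\<omega>. ennreal (\<Psi> (T \<omega>)) \<partial>M)
     = (\<integral>\<^sup>+s. ennreal (\<psi> s * prob {\<omega> \<in> space M. s < T \<omega>}) * indicator {0..} s \<partial>lborel)"
proof -
  interpret pair_sigma_finite M lborel ..
  have "(\<integral>\<^sup>+\<omega>. ennreal (\<Psi> (T \<omega>)) \<partial>M)
     = (\<integral>\<^sup>+\<omega>. (\<integral>\<^sup>+s. ennreal (\<psi> s) * indicator {0..} s * indicator {s. s < T \<omega>} s \<partial>lborel) \<partial>M)"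
  proof (rule nn_integral_cong)
    fix \<omega> assume \<omega>: "\<omega> \<in> space M"
    have "(\<integral>\<^sup>+s. ennreal (\<psi> s) * indicator {0..} s * indicator {s. s < T \<omega>} s \<partial>lborel)
        = (\<integral>\<^sup>+s. ennreal (\<psi> s) * indicator {0..T \<omega>} s \<partial>lborel)"
      using AE_lborel_singleton[of "T \<omega>"]
      by (intro nn_integral_cong_AE) (auto elim!: eventually_mono split: split_indicator)
    also have "\<dots> = ennreal (\<Psi> (T \<omega>) - \<Psi> 0)"
      using T_nonneg[OF \<omega>] \<psi>_nonneg
      by (intro nn_integral_FTC_Icc) (auto intro: has_field_derivative_at_within \<Psi>)
    finally show "ennreal (\<Psi> (T \<omega>)) =
       (\<integral>\<^sup>+s. ennreal (\<psi> s) * indicator {0..} s * indicator {s. s < T \<omega>} s \<partial>lborel)"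
      using \<Psi> by simp
  qed
  also have "\<dots> = (\<integral>\<^sup>+s. (\<integral>\<^sup>+\<omega>. ennreal (\<psi> s) * indicator {0..} s * indicator {s. s < T \<omega>} s \<partial>M) \<partial>lborel)"
    by (rule Fubini'[symmetric]) simp
  also have "\<dots> = (\<integral>\<^sup>+s. ennreal (\<psi> s * prob {\<omega> \<in> space M. s < T \<omega>}) * indicator {0..} s \<partial>lborel)"
  proof (rule nn_integral_cong)
    fix s :: real
    have "(\<integral>\<^sup>+\<omega>. ennreal (\<psi> s) * indicator {0..} s * indicator {s. s < T \<omega>} s \<partial>M)
       = ennreal (\<psi> s) * indicator {0..} s * (\<integral>\<^sup>+\<omega>. indicator {s. s < T \<omega>} s \<partial>M)"
      by (rule nn_integral_cmult) simp
    also have "(\<integral>\<^sup>+\<omega>. indicator {s. s < T \<omega>} s \<partial>M) = (\<integral>\<^sup>+\<omega>. indicator {\<omega> \<in> space M. s < T \<omega>} \<omega> \<partial>M)"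
      by (intro nn_integral_cong) (auto split: split_indicator)
    also have "\<dots> = ennreal (prob {\<omega> \<in> space M. s < T \<omega>})"
      by (simp add: emeasure_eq_measure)
    finally show "(\<integral>\<^sup>+\<omega>. ennreal (\<psi> s) * indicator {0..} s * indicator {s. s < T \<omega>} s \<partial>M)
       = ennreal (\<psi> s * prob {\<omega> \<in> space M. s < T \<omega>}) * indicator {0..} s"
      using \<psi>_nonneg[of s] by (auto simp: ennreal_mult split: split_indicator)
  qed
  finally show ?thesis .
qed

text \<open>The weights may have either sign, so the law of \<open>T\<close> need not be a mixture of exponential laws.
  The minus sign matches the spectral expansion of the distribution function.\<close>

locale exponential_sum_tail = prob_space +
  fixes T :: "'a \<Rightarrow> real" and I :: "nat set" and w r :: "nat \<Rightarrow> real"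
  assumes T [measurable]: "T \<in> borel_measurable M"
    and T_nonneg: "\<omega> \<in> space M \<Longrightarrow> 0 \<le> T \<omega>"
    and r_pos: "i \<in> I \<Longrightarrow> 0 < r i"
    and tail: "0 < t \<Longrightarrow> prob {\<omega> \<in> space M. t < T \<omega>} = - (\<Sum>i\<in>I. w i * exp (- (r i * t)))"
begin

text \<open>At \<open>t = 0\<close> this follows by continuity, the tail formula being known for positive times only.\<close>

lemma tail_nonneg: 
  assumes "0 \<le> t"
  shows "0 \<le> - (\<Sum>i\<in>I. w i * exp (- (r i * t)))"
proof (cases "t = 0")
  case True
  have lim: "((\<lambda>t. - (\<Sum>i\<in>I. w i * exp (- (r i * t)))) \<longlongrightarrow> - (\<Sum>i\<in>I. w i * exp (- (r i * 0)))) (at_right 0)"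
    by (intro tendsto_intros)
  have "\<forall>\<^sub>F t in at_right 0. 0 \<le> - (\<Sum>i\<in>I. w i * exp (- (r i * t)))"
    using eventually_at_right_less[of 0] by eventually_elim (simp flip: tail)
  from tendsto_lowerbound[OF lim this] show ?thesis using True by simp
qed (use assms in \<open>simp flip: tail\<close>)

text \<open>\<open>H i\<close> is the antiderivative of \<open>- \<psi> s * exp (- r i * s)\<close> that vanishes at infinity. The second
  claim makes the value on the right of the first one a genuine real number rather than a truncated
  one.\<close>

lemma nn_integral_of_tail:
  assumes [measurable]: "\<psi> \<in> borel_measurable borel" and \<psi>_nonneg: "\<And>s. 0 \<le> s \<Longrightarrow> 0 \<le> \<psi> s"
    and \<Psi>: "\<And>s. (\<Psi> has_real_derivative \<psi> s) (at s)" "\<Psi> 0 = 0"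
    and H: "\<And>i s. i \<in> I \<Longrightarrow> (H i has_real_derivative - (\<psi> s * exp (- (r i * s)))) (at s)"
    and H_lim: "\<And>i. i \<in> I \<Longrightarrow> (H i \<longlongrightarrow> 0) at_top"
  shows "(\<integral>\<^sup>+\<omega>. ennreal (\<Psi> (T \<omega>)) \<partial>M) = ennreal (- (\<Sum>i\<in>I. w i * H i 0))"
    and "(\<Sum>i\<in>I. w i * H i 0) \<le> 0"
proof -
  let ?F = "\<lambda>s. \<Sum>i\<in>I. w i * H i s"
  let ?f = "\<lambda>s. \<psi> s * - (\<Sum>i\<in>I. w i * exp (- (r i * s)))"
  have F_deriv: "(?F has_real_derivative ?f s) (at s)" for s
  proof -
    have "(?F has_real_derivative (\<Sum>i\<in>I. w i * - (\<psi> s * exp (- (r i * s))))) (at s)"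
      by (intro DERIV_sum DERIV_cmult H)
    also have "(\<Sum>i\<in>I. w i * - (\<psi> s * exp (- (r i * s)))) = ?f s"
      by (simp add: sum_distrib_left sum_negf mult_ac)
    finally show ?thesis .
  qed
  have f_nonneg: "0 \<le> ?f s" if "0 \<le> s" for s
    using that by (intro mult_nonneg_nonneg \<psi>_nonneg tail_nonneg)
  have "(?F \<longlongrightarrow> (\<Sum>i\<in>I. w i * 0)) at_top"
    by (intro tendsto_sum tendsto_mult tendsto_const H_lim)
  then have F_lim: "(?F \<longlongrightarrow> 0) at_top" by simp
  have "(\<integral>\<^sup>+\<omega>. ennreal (\<Psi> (T \<omega>)) \<partial>M)
     = (\<integral>\<^sup>+s. ennreal (\<psi> s * prob {\<omega> \<in> space M. s < T \<omega>}) * indicator {0..} s \<partial>lborel)"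
    using assms by (intro nn_integral_layer_cake T T_nonneg)
  also have "\<dots> = (\<integral>\<^sup>+s. ennreal (?f s) * indicator {0..} s \<partial>lborel)"
    using AE_lborel_singleton[of "0 :: real"]
    by (intro nn_integral_cong_AE) (auto elim!: eventually_mono simp: tail split: split_indicator)
  also have "\<dots> = ennreal (0 - ?F 0)"
    by (intro nn_integral_FTC_atLeast F_deriv F_lim f_nonneg) measurable
  finally show "(\<integral>\<^sup>+\<omega>. ennreal (\<Psi> (T \<omega>)) \<partial>M) = ennreal (- ?F 0)" by simp
  have "?F 0 \<le> ?F s" if "0 \<le> s" for s
    by (rule DERIV_nonneg_imp_nondecreasing[OF that]) (use F_deriv f_nonneg in blast)
  then have "\<forall>\<^sub>F s in at_top. ?F 0 \<le> ?F s"
    by (intro eventually_mono[OF eventually_ge_at_top[of 0]])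
  then show "?F 0 \<le> 0"
    using tendsto_lowerbound[OF F_lim] by simp
qed

lemma integral_of_tail:
  assumes \<psi>: "\<psi> \<in> borel_measurable borel" "\<And>s. 0 \<le> s \<Longrightarrow> 0 \<le> \<psi> s"
    and \<Psi>: "\<And>s. (\<Psi> has_real_derivative \<psi> s) (at s)" "\<Psi> 0 = 0"
    and H: "\<And>i s. i \<in> I \<Longrightarrow> (H i has_real_derivative - (\<psi> s * exp (- (r i * s)))) (at s)"
    and H_lim: "\<And>i. i \<in> I \<Longrightarrow> (H i \<longlongrightarrow> 0) at_top"
  shows "integrable M (\<lambda>\<omega>. \<Psi> (T \<omega>))" "expectation (\<lambda>\<omega>. \<Psi> (T \<omega>)) = - (\<Sum>i\<in>I. w i * H i 0)"
proof -
  have \<Psi>_nonneg: "0 \<le> \<Psi> s" if "0 \<le> s" for s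
    using DERIV_nonneg_imp_nondecreasing[of 0 s \<Psi>] \<Psi> \<psi>(2) that by force
  have [measurable]: "\<Psi> \<in> borel_measurable borel"
    by (intro borel_measurable_continuous_onI) (meson DERIV_isCont \<Psi>(1) continuous_at_imp_continuous_on)
  note nn = nn_integral_of_tail[OF assms]
  have "(\<lambda>\<omega>. \<Psi> (T \<omega>)) \<in> borel_measurable M" by measurable
  moreover have ae: "AE \<omega> in M. 0 \<le> \<Psi> (T \<omega>)" using T_nonneg \<Psi>_nonneg by auto
  ultimately show int: "integrable M (\<lambda>\<omega>. \<Psi> (T \<omega>))"
    using nn(1) by (intro integrableI_nonneg) auto
  have "ennreal (expectation (\<lambda>\<omega>. \<Psi> (T \<omega>))) = ennreal (- (\<Sum>i\<in>I. w i * H i 0))"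
    using nn_integral_eq_integral[OF int ae] nn(1) by simp
  moreover have "0 \<le> - (\<Sum>i\<in>I. w i * H i 0)"
    using nn(2) by simp
  moreover have "0 \<le> expectation (\<lambda>\<omega>. \<Psi> (T \<omega>))" using ae by (rule integral_nonneg_AE)
  ultimately show "expectation (\<lambda>\<omega>. \<Psi> (T \<omega>)) = - (\<Sum>i\<in>I. w i * H i 0)" by simp
qed

lemma expectation_T:
  "integrable M T" "expectation T = - (\<Sum>i\<in>I. w i / r i)"
proof -
  let ?H = "\<lambda>i s. exp (- (r i * s)) / r i"
  have H: "(?H i has_real_derivative - (1 * exp (- (r i * s)))) (at s)" if "i \<in> I" for i s
    using r_pos[OF that] by (auto intro!: derivative_eq_intros)
  have H_lim: "(?H i \<longlongrightarrow> 0) at_top" if "i \<in> I" for i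
    using r_pos[OF that] by real_asymp
  note * = integral_of_tail[where \<psi> = "\<lambda>_. 1" and \<Psi> = "\<lambda>s. s" and H = ?H, OF _ _ _ _ H H_lim]
  show "integrable M T" by (rule *(1)) auto
  show "expectation T = - (\<Sum>i\<in>I. w i / r i)" by (subst *(2)) auto
qed

lemma expectation_T_squared:
  "integrable M (\<lambda>\<omega>. (T \<omega>)\<^sup>2)" "expectation (\<lambda>\<omega>. (T \<omega>)\<^sup>2) = - 2 * (\<Sum>i\<in>I. w i / (r i)\<^sup>2)"
proof -
  let ?H = "\<lambda>i s. 2 * (s / r i + 1 / (r i)\<^sup>2) * exp (- (r i * s))"
  have H: "(?H i has_real_derivative - (2 * s * exp (- (r i * s)))) (at s)" if "i \<in> I" for i s
    using r_pos[OF that] by (auto intro!: derivative_eq_intros simp: field_simps power2_eq_square)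
  have H_lim: "(?H i \<longlongrightarrow> 0) at_top" if "i \<in> I" for i
    using r_pos[OF that] by real_asymp
  note * = integral_of_tail[where \<psi> = "\<lambda>s. 2 * s" and \<Psi> = "\<lambda>s. s\<^sup>2" and H = ?H, OF _ _ _ _ H H_lim]
  show "integrable M (\<lambda>\<omega>. (T \<omega>)\<^sup>2)"
    by (rule *(1)) (auto intro!: derivative_eq_intros)
  show "expectation (\<lambda>\<omega>. (T \<omega>)\<^sup>2) = - 2 * (\<Sum>i\<in>I. w i / (r i)\<^sup>2)"
    by (subst *(2)) (auto intro!: derivative_eq_intros simp: sum_distrib_left sum_negf mult_ac)
qed

lemma expectation_exp_T:
  assumes "0 < \<alpha>"
  shows "expectation (\<lambda>\<omega>. exp (- \<alpha> * T \<omega>)) = 1 + (\<Sum>i\<in>I. w i * (\<alpha> / (\<alpha> + r i)))"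
proof -
  let ?H = "\<lambda>i s. \<alpha> / (\<alpha> + r i) * exp (- ((\<alpha> + r i) * s))"
  have H: "(?H i has_real_derivative - (\<alpha> * exp (- \<alpha> * s) * exp (- (r i * s)))) (at s)"
    if "i \<in> I" for i s
  proof -
    have ne: "\<alpha> + r i \<noteq> 0" using r_pos[OF that] assms by simp
    have "(?H i has_real_derivative \<alpha> / (\<alpha> + r i) * (exp (- ((\<alpha> + r i) * s)) * - (\<alpha> + r i))) (at s)"
      by (intro DERIV_cmult) (auto intro!: derivative_eq_intros)
    also have "\<alpha> / (\<alpha> + r i) * (exp (- ((\<alpha> + r i) * s)) * - (\<alpha> + r i)) = - (\<alpha> * exp (- ((\<alpha> + r i) * s)))"
      using ne by (simp add: field_simps)
    also have "exp (- ((\<alpha> + r i) * s)) = exp (- \<alpha> * s) * exp (- (r i * s))"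
      by (simp add: algebra_simps flip: exp_add)
    finally show ?thesis by (simp only: mult.assoc)
  qed
  have H_lim: "(?H i \<longlongrightarrow> 0) at_top" if "i \<in> I" for i
  proof -
    have "0 < \<alpha> + r i" using r_pos[OF that] assms by simp
    then show ?thesis by real_asymp
  qed
  note * = integral_of_tail[where \<psi> = "\<lambda>s. \<alpha> * exp (- \<alpha> * s)" and \<Psi> = "\<lambda>s. 1 - exp (- \<alpha> * s)"
      and H = ?H, OF _ _ _ _ H H_lim]
  have "expectation (\<lambda>\<omega>. 1 - exp (- \<alpha> * T \<omega>)) = - (\<Sum>i\<in>I. w i * ?H i 0)"
    by (rule *(2)) (use assms in \<open>auto intro!: derivative_eq_intros\<close>)
  moreover have "integrable M (\<lambda>\<omega>. exp (- \<alpha> * T \<omega>))"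
    using assms T_nonneg by (intro integrable_const_bound[where B = 1]) auto
  ultimately show ?thesis by (simp add: prob_space)
qed

end

section \<open>Metropolis-Hastings generators and fastest strong stationary times\<close>

text \<open>Multiplied by \<open>pmf \<mu> x\<close>, the rate from \<open>x\<close> to \<open>y\<close> becomes \<open>c\<close> of the two probability flows
  \<open>pmf \<mu> x * Q $$ (x, y)\<close> and \<open>pmf \<mu> y * Q $$ (y, x)\<close>, because \<open>c\<close> is homogeneous; as \<open>c\<close> is symmetric,
  this is detailed balance. Both \<open>min\<close> and \<open>max\<close> qualify.\<close>

lemma metropolis_hastings_birth_death:
  fixes c :: "real \<Rightarrow> real \<Rightarrow> real" and \<mu> :: "nat pmf"
  assumes \<mu>: "set_pmf \<mu> = {0..n}" and Q: "ergodic_birth_death n Q"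
    and c_zero: "c 0 0 = 0" and c_pos: "\<And>s t. 0 < s \<Longrightarrow> 0 < t \<Longrightarrow> 0 < c s t"
    and c_commute: "\<And>s t. c s t = c t s"
    and c_scale: "\<And>k s t. 0 < k \<Longrightarrow> k * c s t = c (k * s) (k * t)"
  defines "r \<equiv> \<lambda>x y. c (Q $$ (x, y)) (pmf \<mu> y / pmf \<mu> x * Q $$ (y, x))"
  defines "b \<equiv> \<lambda>x. if x < n then r x (Suc x) else 0"
    and "d \<equiv> \<lambda>x. if 0 < x \<and> x \<le> n then r x (x - 1) else 0"
  shows "reversible_birth_death n (pmf \<mu>) b d"
    and "metropolis_hastings c n Q \<mu> = reversible_birth_death.gen_mat n b d"
proof -
  have \<mu>_pos: "0 < pmf \<mu> x" if "x \<le> n" for x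
    using \<mu> that by (simp add: pmf_positive)
  have Q_pos: "0 < Q $$ (x, Suc x)" "0 < Q $$ (Suc x, x)" if "x < n" for x
    using Q that by (auto simp: ergodic_birth_death_def)
  have Q_zero: "Q $$ (x, y) = 0" if "x \<le> n" "y \<le> n" "x \<noteq> y" "\<bar>int x - int y\<bar> \<noteq> 1" for x y
  proof -
    have "x \<in> {0..n}" "y \<in> {0..n}" using that by auto
    then have "0 \<le> Q $$ (x, y)" "\<not> 0 < Q $$ (x, y)"
      using Q that unfolding ergodic_birth_death_def generator_def by blast+
    then show ?thesis by simp
  qed
  have r_zero: "r x y = 0" if "x \<le> n" "y \<le> n" "x \<noteq> y" "y \<noteq> Suc x" "x \<noteq> Suc y" for x y
    using Q_zero[of x y] Q_zero[of y x] that by (simp add: r_def c_zero)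
  show rbd: "reversible_birth_death n (pmf \<mu>) b d"
  proof
    show "0 < pmf \<mu> x" if "x \<le> n" for x by (rule \<mu>_pos[OF that])
    show "(\<Sum>x\<le>n. pmf \<mu> x) = 1" using \<mu> by (intro sum_pmf_eq_1) auto
    show "0 < b x" if "x < n" for x
      using that Q_pos[OF that] \<mu>_pos[of x] \<mu>_pos[of "Suc x"] by (simp add: b_def r_def c_pos)
    show "pmf \<mu> x * b x = pmf \<mu> (Suc x) * d (Suc x)" if "x < n" for x
    proof -
      have p: "0 < pmf \<mu> x" "0 < pmf \<mu> (Suc x)" using that by (auto intro: \<mu>_pos)
      have "pmf \<mu> x * r x (Suc x) = c (pmf \<mu> x * Q $$ (x, Suc x)) (pmf \<mu> (Suc x) * Q $$ (Suc x, x))"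
        using p by (simp add: r_def c_scale)
      also have "\<dots> = pmf \<mu> (Suc x) * r (Suc x) x"
        using p by (subst c_commute) (simp add: r_def c_scale)
      finally show ?thesis using that by (simp add: b_def d_def)
    qed
  qed (auto simp: b_def d_def)
  interpret reversible_birth_death n "pmf \<mu>" b d by (rule rbd)
  have exit_rate: "(\<Sum>z\<in>{0..n} - {x}. r x z) = b x + d x" if "x \<le> n" for x
  proof -
    have "(\<Sum>z\<in>{0..n} - {x}. r x z)
       = (\<Sum>z\<in>{0..n} - {x}. (if z = Suc x then b x else 0) + (if z = x - 1 then d x else 0))"
      using that by (intro sum.cong) (auto simp: b_def d_def r_zero)
    also have "\<dots> = b x + d x"
      using that by (auto simp: sum.distrib b_def d_def)
    finally show ?thesis .
  qed
  show "metropolis_hastings c n Q \<mu> = gen_mat"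
  proof (rule eq_matI)
    fix x y assume "x < dim_row gen_mat" "y < dim_col gen_mat"
    then have xy: "x \<le> n" "y \<le> n" by auto
    have "metropolis_hastings c n Q \<mu> $$ (x, y) = (if x = y then - (\<Sum>z\<in>{0..n} - {x}. r x z) else r x y)"
      using xy by (simp add: metropolis_hastings_def r_def Let_def)
    also have "\<dots> = gen_mat $$ (x, y)"
      unfolding gen_mat_def using xy by (auto simp: exit_rate b_def d_def r_zero)
    finally show "metropolis_hastings c n Q \<mu> $$ (x, y) = gen_mat $$ (x, y)" .
  qed (auto simp: metropolis_hastings_def Let_def)
qed

lemma (in reversible_birth_death) obtain_spectrum:
  obtains lam u where "birth_death_spectrum n m b d lam u"
proof -
  obtain lam u where "strict_mono_on {..n} lam" "\<forall>i\<le>n. \<forall>x\<le>n. L (u i) x = lam i * u i x"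
    "\<forall>i\<le>n. \<forall>j\<le>n. inner_m (u i) (u j) = (if i = j then 1 else 0)"
    using exists_orthonormal_eigenbasis by blast
  then have "birth_death_spectrum n m b d lam u"
    by unfold_locales auto
  then show thesis by (rule that)
qed

context birth_death_spectrum
begin

lemma eigval_gen_mat: "i \<in> {1..Suc n} \<Longrightarrow> eigval i gen_mat = lam (i - 1)"
  unfolding eigval_def neg_eigenvalues_gen_mat by (subst nth_map) (auto simp del: upt_Suc)

context
  fixes \<pi> :: "nat pmf" and P :: "'a measure" and F :: "real \<Rightarrow> 'a measure"
    and X :: "real \<Rightarrow> 'a \<Rightarrow> nat" and T :: "'a \<Rightarrow> real"
  assumes fsst: "fastest_strong_stationary_time n gen_mat \<pi> P F X T" and \<pi>: "pmf \<pi> = m"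
begin

lemma fastest_sst_exponential_sum_tail: "exponential_sum_tail P T {1..n} w lam"
proof -
  have chain: "markov_chain_from_0 n gen_mat P F X" and stop: "stopping_time F T"
    and nonneg: "\<And>\<omega>. \<omega> \<in> space P \<Longrightarrow> 0 \<le> T \<omega>"
    and tail: "\<And>t. 0 < t \<Longrightarrow> measure P {\<omega> \<in> space P. T \<omega> > t}
        = (MAX y\<in>{0..n}. 1 - mat_exp (t \<cdot>\<^sub>m gen_mat) $$ (0, y) / pmf \<pi> y)"
    using fsst unfolding fastest_strong_stationary_time_def strong_stationary_time_def by blast+
  have "prob_space P" and filt: "filtration (space P) F" and sub: "\<And>t. sets (F t) \<subseteq> sets P"
    using chain unfolding markov_chain_from_0_def by blast+
  interpret prob_space P by fact
  show ?thesis
  proof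
    show "T \<in> borel_measurable P"
      by (rule measurable_stopping_time[OF stop sub]) (rule filtration.space_F[OF filt])
    show "prob {\<omega> \<in> space P. t < T \<omega>} = - (\<Sum>i=1..n. w i * exp (- (lam i * t)))" if "0 < t" for t
      using tail[OF that] separation_eq[OF that] by (simp add: \<pi>)
  qed (use nonneg lam_pos in auto)
qed

text \<open>The Laplace transform of a sum of independent exponential variables with rates
  \<open>lam 1, \<dots>, lam n\<close>; the first two moments below are those of the same law.\<close>

lemma laplace_transform_fastest_sst:
  assumes "0 < \<alpha>"
  shows "prob_space.expectation P (\<lambda>\<omega>. exp (- \<alpha> * T \<omega>)) = (\<Prod>j=1..n. lam j / (\<alpha> + lam j))"
proof -
  interpret exponential_sum_tail P T "{1..n}" w lam by (rule fastest_sst_exponential_sum_tail)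
  have "0 < \<alpha> + lam j" if "j \<in> {1..n}" for j using lam_pos[of j] that assms by auto
  from expectation_exp_T[OF assms] partial_fractions[OF this] show ?thesis by simp
qed

lemma moments_fastest_sst:
  shows "integrable P T" "integrable P (\<lambda>\<omega>. (T \<omega>)\<^sup>2)"
    and "prob_space.expectation P T = (\<Sum>i=1..n. 1 / lam i)"
    and "prob_space.variance P T = (\<Sum>i=1..n. 1 / (lam i)\<^sup>2)"
proof -
  interpret exponential_sum_tail P T "{1..n}" w lam by (rule fastest_sst_exponential_sum_tail)
  show int: "integrable P T" "integrable P (\<lambda>\<omega>. (T \<omega>)\<^sup>2)"
    by (fact expectation_T(1) expectation_T_squared(1))+
  show E: "expectation T = (\<Sum>i=1..n. 1 / lam i)"
    using expectation_T(2) inverse_power_sums(1) by simp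
  show "variance T = (\<Sum>i=1..n. 1 / (lam i)\<^sup>2)"
    using variance_eq[OF int] expectation_T_squared(2) inverse_power_sums(2) E by simp
qed

end

end

theorem proposition5p2:
  fixes n :: nat and \<mu> :: "nat pmf" and Q :: "real mat"
    and P1 :: "'a measure" and F1 :: "real \<Rightarrow> 'a measure" and X1 :: "real \<Rightarrow> 'a \<Rightarrow> nat"
    and T1 :: "'a \<Rightarrow> real"
    and P2 :: "'b measure" and F2 :: "real \<Rightarrow> 'b measure" and X2 :: "real \<Rightarrow> 'b \<Rightarrow> nat"
    and T2 :: "'b \<Rightarrow> real"
  assumes "set_pmf \<mu> = {0..n}"
    and "ergodic_birth_death n Q"
  shows "(\<forall>G\<in>{M\<^sub>1 n Q \<mu>, M\<^sub>2 n Q \<mu>}.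
            length (neg_eigenvalues G) = Suc n \<and> eigval 1 G = 0)
      \<and> (\<forall>i\<in>{1..Suc n}. eigval i (M\<^sub>1 n Q \<mu>) \<le> eigval i (M\<^sub>2 n Q \<mu>))
      \<and> (fastest_strong_stationary_time n (M\<^sub>1 n Q \<mu>) \<mu> P1 F1 X1 T1 \<longrightarrow>
         fastest_strong_stationary_time n (M\<^sub>2 n Q \<mu>) \<mu> P2 F2 X2 T2 \<longrightarrow>
           (\<forall>\<alpha>>0. prob_space.expectation P2 (\<lambda>\<omega>. exp (- \<alpha> * T2 \<omega>))
                     \<ge> prob_space.expectation P1 (\<lambda>\<omega>. exp (- \<alpha> * T1 \<omega>)))
         \<and> integrable P1 T1 \<and> integrable P1 (\<lambda>\<omega>. (T1 \<omega>)\<^sup>2)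
         \<and> integrable P2 T2 \<and> integrable P2 (\<lambda>\<omega>. (T2 \<omega>)\<^sup>2)
         \<and> prob_space.expectation P2 T2 \<le> prob_space.expectation P1 T1
         \<and> prob_space.variance P2 T2 \<le> prob_space.variance P1 T1)"
proof -
  let ?r = "\<lambda>c x y. c (Q $$ (x, y)) (pmf \<mu> y / pmf \<mu> x * Q $$ (y, x))"
  define b where "b c x = (if x < n then ?r c x (Suc x) else 0)"
    for c :: "real \<Rightarrow> real \<Rightarrow> real" and x
  define d where "d c x = (if 0 < x \<and> x \<le> n then ?r c x (x - 1) else 0)"
    for c :: "real \<Rightarrow> real \<Rightarrow> real" and x
  have rbd: "reversible_birth_death n (pmf \<mu>) (b min) (d min)" "reversible_birth_death n (pmf \<mu>) (b max) (d max)"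
    and M: "M\<^sub>1 n Q \<mu> = reversible_birth_death.gen_mat n (b min) (d min)"
      "M\<^sub>2 n Q \<mu> = reversible_birth_death.gen_mat n (b max) (d max)"
    unfolding M\<^sub>1_def M\<^sub>2_def b_def d_def
    by (rule metropolis_hastings_birth_death[OF assms];
        auto simp: min_mult_distrib_left max_mult_distrib_left min.commute max.commute)+
  obtain lam1 u1 where S1: "birth_death_spectrum n (pmf \<mu>) (b min) (d min) lam1 u1"
    using reversible_birth_death.obtain_spectrum[OF rbd(1)] by blast
  obtain lam2 u2 where S2: "birth_death_spectrum n (pmf \<mu>) (b max) (d max) lam2 u2"
    using reversible_birth_death.obtain_spectrum[OF rbd(2)] by blast
  interpret S1: birth_death_spectrum n "pmf \<mu>" "b min" "d min" lam1 u1 by (fact S1)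
  interpret S2: birth_death_spectrum n "pmf \<mu>" "b max" "d max" lam2 u2 by (fact S2)
  have le: "lam1 i \<le> lam2 i" if "i \<le> n" for i
    using eigenvalues_mono_in_rates[OF S1 S2 _ that] by (simp add: b_def)
  have pos: "0 < lam1 j" "0 < lam2 j" "lam1 j \<le> lam2 j" if "j \<in> {1..n}" for j
    using that S1.lam_pos[of j] S2.lam_pos[of j] le[of j] by auto
  have "\<forall>G\<in>{M\<^sub>1 n Q \<mu>, M\<^sub>2 n Q \<mu>}. length (neg_eigenvalues G) = Suc n \<and> eigval 1 G = 0"
    unfolding M by (auto simp: S1.neg_eigenvalues_gen_mat S2.neg_eigenvalues_gen_mat
        S1.eigval_gen_mat S2.eigval_gen_mat S1.lam_0 S2.lam_0)
  moreover have "\<forall>i\<in>{1..Suc n}. eigval i (M\<^sub>1 n Q \<mu>) \<le> eigval i (M\<^sub>2 n Q \<mu>)"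
    unfolding M by (auto simp: S1.eigval_gen_mat S2.eigval_gen_mat le)
  moreover
  {
    assume T1: "fastest_strong_stationary_time n (M\<^sub>1 n Q \<mu>) \<mu> P1 F1 X1 T1"
      and T2: "fastest_strong_stationary_time n (M\<^sub>2 n Q \<mu>) \<mu> P2 F2 X2 T2"
    note m1 = S1.moments_fastest_sst[OF T1[unfolded M] refl]
      and m2 = S2.moments_fastest_sst[OF T2[unfolded M] refl]
    have "prob_space.expectation P1 (\<lambda>\<omega>. exp (- \<alpha> * T1 \<omega>)) \<le> prob_space.expectation P2 (\<lambda>\<omega>. exp (- \<alpha> * T2 \<omega>))"
      if "0 < \<alpha>" for \<alpha>
      unfolding S1.laplace_transform_fastest_sst[OF T1[unfolded M] refl that]
        S2.laplace_transform_fastest_sst[OF T2[unfolded M] refl that]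
    proof (rule prod_mono, rule conjI)
      fix j assume j: "j \<in> {1..n}"
      show "0 \<le> lam1 j / (\<alpha> + lam1 j)" using pos[OF j] that by simp
      have "\<alpha> * lam1 j \<le> \<alpha> * lam2 j" using pos[OF j] that by simp
      then show "lam1 j / (\<alpha> + lam1 j) \<le> lam2 j / (\<alpha> + lam2 j)"
        using pos[OF j] that by (simp add: field_simps)
    qed
    moreover have "prob_space.expectation P2 T2 \<le> prob_space.expectation P1 T1"
      unfolding m1(3) m2(3) using pos by (intro sum_mono divide_left_mono) auto
    moreover have "prob_space.variance P2 T2 \<le> prob_space.variance P1 T1"
      unfolding m1(4) m2(4) using pos by (intro sum_mono frac_le power_mono zero_less_power) (auto simp: less_imp_le)
    ultimately have "(\<forall>\<alpha>>0. prob_space.expectation P2 (\<lambda>\<omega>. exp (- \<alpha> * T2 \<omega>))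
                     \<ge> prob_space.expectation P1 (\<lambda>\<omega>. exp (- \<alpha> * T1 \<omega>)))
         \<and> integrable P1 T1 \<and> integrable P1 (\<lambda>\<omega>. (T1 \<omega>)\<^sup>2)
         \<and> integrable P2 T2 \<and> integrable P2 (\<lambda>\<omega>. (T2 \<omega>)\<^sup>2)
         \<and> prob_space.expectation P2 T2 \<le> prob_space.expectation P1 T1
         \<and> prob_space.variance P2 T2 \<le> prob_space.variance P1 T1"
      using m1(1,2) m2(1,2) by blast
  }
  ultimately show ?thesis by blast
qed

end
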